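(* Let $\phi^0:[0,1]\to\mathbb R$ be $1$-Lipschitz with $\phi^0(0)=0$. For $L\in\mathbb N$ let $(h(t))_{t\ge0}$ be the corner-flip dynamics on $\Omega_{M_L,N_L}$ ($M_L+N_L=L$) started from $$h^0_x=2\lfloor L\phi^0(x/L)/2\rfloor\ (x\text{ even}),\qquad h^0_x=2\lfloor (L\phi^0(x/L)-1)/2\rfloor+1\ (x\text{ odd}),$$ ($M_L,N_L$ being determined by $h^0_L$). Then for all $T\ge0$ and $\varepsilon>0$, with probability tending to $1$ as $L\to\infty$, $$\sup_{t\in[0,T],\,x\in[0,1]}\frac1L\big|h_{\lfloor xL\rfloor}(L^2t)-L\phi(x,t)\big|\le\varepsilon,$$ where $\phi$ solves $\partial_t\phi=\frac12\partial_x^2\phi$ on $(0,1)\times(0,\infty)$ with $\phi(0,t)=0$, $\phi(1,t)=\phi^0(1)$ for $t>0$ and $\phi(x,0)=\phi^0(x)$.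
   Context: For positive integers $M,N$, $\Omega_{M,N}=\{(h_x)_{x\in\{0,\dots,M+N\}}\in\mathbb Z^{M+N+1}: |h_{x+1}-h_x|=1,\ h_0=0,\ h_{M+N}=M-N\}$. Write $L=M+N$. For $h\in\Omega_{M,N}$ and $x\in\{1,\dots,L-1\}$, $h^{(x)}$ agrees with $h$ off $x$ and $h^{(x)}_x=h_x-2$ if $h_{x\pm1}=h_x-1$, $h^{(x)}_x=h_x+2$ if $h_{x\pm1}=h_x+1$, and $h^{(x)}_x=h_x$ otherwise. The corner-flip dynamics is the Markov chain with generator $\mathcal Lf(h)=\frac12\sum_{x=1}^{L-1}(f(h^{(x)})-f(h))$. *)

theory Defs
  imports "HOL-Probability.Probability"
begin

text \<open>Height profiles are functions nat => int, extended by 0 beyond L = M + N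
  (so that the state space is a finite set of functions).\<close>

definition Omega :: "nat \<Rightarrow> nat \<Rightarrow> (nat \<Rightarrow> int) set" where
  "Omega M N = {h. h 0 = 0 \<and> (\<forall>x < M + N. \<bar>h (Suc x) - h x\<bar> = 1)
                  \<and> h (M + N) = int M - int N \<and> (\<forall>x > M + N. h x = 0)}"

definition flip :: "(nat \<Rightarrow> int) \<Rightarrow> nat \<Rightarrow> (nat \<Rightarrow> int)" where
  "flip h x =
     (if h (x - 1) = h x - 1 \<and> h (x + 1) = h x - 1 then h(x := h x - 2)
      else if h (x - 1) = h x + 1 \<and> h (x + 1) = h x + 1 then h(x := h x + 2)
      else h)"

text \<open>Matrix of the generator  (Lf)(h) = 1/2 sum_{x=1}^{L-1} (f(h^(x)) - f(h)),
  i.e. (Lf)(a) = sum_b Q a b * f b.\<close>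
definition cf_rate :: "nat \<Rightarrow> (nat \<Rightarrow> int) \<Rightarrow> (nat \<Rightarrow> int) \<Rightarrow> real" where
  "cf_rate L a b = (1/2) * real (card {x \<in> {1..<L}. flip a x = b})
                   - (if a = b then (1/2) * real (card {1..<L}) else 0)"

fun Qpow :: "'s set \<Rightarrow> ('s \<Rightarrow> 's \<Rightarrow> real) \<Rightarrow> nat \<Rightarrow> 's \<Rightarrow> 's \<Rightarrow> real" where
  "Qpow S Q 0 a b = (if a = b then 1 else 0)"
| "Qpow S Q (Suc n) a b = (\<Sum>c\<in>S. Q a c * Qpow S Q n c b)"

definition trans_prob :: "'s set \<Rightarrow> ('s \<Rightarrow> 's \<Rightarrow> real) \<Rightarrow> real \<Rightarrow> 's \<Rightarrow> 's \<Rightarrow> real" where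
  "trans_prob S Q t a b = (\<Sum>n. t ^ n / fact n * Qpow S Q n a b)"

definition markov_chain_gen ::
  "'w measure \<Rightarrow> (real \<Rightarrow> 'w \<Rightarrow> 's) \<Rightarrow> 's set \<Rightarrow> ('s \<Rightarrow> 's \<Rightarrow> real) \<Rightarrow> 's \<Rightarrow> bool" where
  "markov_chain_gen M X S Q x0 \<longleftrightarrow>
     prob_space M
   \<and> (\<forall>t\<ge>0. X t \<in> measurable M (count_space UNIV))
   \<and> (\<forall>\<omega>\<in>space M. \<forall>t\<ge>0. X t \<omega> \<in> S)
   \<and> (\<forall>\<omega>\<in>space M. \<forall>t\<ge>0.
        (\<exists>\<delta>>0. \<forall>s\<in>{t..<t+\<delta>}. X s \<omega> = X t \<omega>)
      \<and> (t > 0 \<longrightarrow> (\<exists>\<delta>>0. \<exists>y. \<forall>s\<in>{t-\<delta><..<t}. X s \<omega> = y)))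
   \<and> (\<forall>(n::nat) (ts::nat \<Rightarrow> real) (xs::nat \<Rightarrow> 's).
        0 \<le> ts 0 \<longrightarrow> (\<forall>i<n. ts i \<le> ts (Suc i)) \<longrightarrow> (\<forall>i\<le>n. xs i \<in> S) \<longrightarrow>
        measure M {\<omega>\<in>space M. \<forall>i\<le>n. X (ts i) \<omega> = xs i}
          = trans_prob S Q (ts 0) x0 (xs 0)
            * (\<Prod>i<n. trans_prob S Q (ts (Suc i) - ts i) (xs i) (xs (Suc i))))"

definition corner_flip_process ::
  "'w measure \<Rightarrow> (real \<Rightarrow> 'w \<Rightarrow> nat \<Rightarrow> int) \<Rightarrow> nat \<Rightarrow> nat \<Rightarrow> (nat \<Rightarrow> int) \<Rightarrow> bool" where
  "corner_flip_process P X M N h0 = markov_chain_gen P X (Omega M N) (cf_rate (M + N)) h0"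

definition init_profile :: "(real \<Rightarrow> real) \<Rightarrow> nat \<Rightarrow> nat \<Rightarrow> int" where
  "init_profile phi0 L x =
     (if x \<le> L then
        (if even x then 2 * \<lfloor>real L * phi0 (real x / real L) / 2\<rfloor>
         else 2 * \<lfloor>(real L * phi0 (real x / real L) - 1) / 2\<rfloor> + 1)
      else 0)"

text \<open>M_L, N_L determined by M_L + N_L = L and M_L - N_L = h0_L.\<close>
definition M_L :: "(real \<Rightarrow> real) \<Rightarrow> nat \<Rightarrow> nat" where
  "M_L phi0 L = nat ((int L + init_profile phi0 L L) div 2)"

definition N_L :: "(real \<Rightarrow> real) \<Rightarrow> nat \<Rightarrow> nat" where
  "N_L phi0 L = L - M_L phi0 L"

definition heat_solution :: "(real \<Rightarrow> real) \<Rightarrow> (real \<Rightarrow> real \<Rightarrow> real) \<Rightarrow> bool" where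
  "heat_solution phi0 phi \<longleftrightarrow>
     continuous_on ({0..1} \<times> {0..}) (\<lambda>(x, t). phi x t)
   \<and> (\<forall>x\<in>{0<..<1}. \<forall>t>0. \<exists>g dt.
        (\<forall>y\<in>{0<..<1}. ((\<lambda>z. phi z t) has_real_derivative g y) (at y))
      \<and> ((\<lambda>s. phi x s) has_real_derivative dt) (at t)
      \<and> (g has_real_derivative 2 * dt) (at x))
   \<and> (\<forall>t>0. phi 0 t = 0 \<and> phi 1 t = phi0 1)
   \<and> (\<forall>x\<in>{0..1}. phi x 0 = phi0 x)"

end

theory Submission
  imports Defs "HOL-Real_Asymp.Real_Asymp"
begin

text \<open>
  The mean of the height at a site solves the discrete heat equation, and the generator applied to
  products of heights shows that the covariance of the heights at \<open>x\<close> and \<open>y\<close> solves the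
  two-dimensional discrete heat equation with a source of strength at most 2 on the diagonal, for
  which \<open>L - \<bar>x - y\<bar>\<close> is a supersolution. Hence each height has variance at most \<open>L\<close>, which
  is negligible on the scale \<open>L\<^sup>2\<close>. To pass to a supremum over time, Ottaviani's inequality on
  time windows of length \<open>\<delta> L\<^sup>2\<close> is enough: from any configuration the height at a site moves by
  more than \<open>r\<close> in time at most \<open>r\<^sup>2 / 4\<close> with probability at most \<open>4 L / r\<^sup>2\<close>. The supremum over
  space follows since profiles are Lipschitz. Finally the rescaled mean converges to the solution of
  the heat equation: both obey a maximum principle, so \<open>\<phi>\<^sup>0\<close> may be replaced by an affine function
  plus a sine polynomial, for which both evolutions are explicit.
\<close>

section \<open>Finite-state Markov semigroups\<close>

text \<open>The chain is known only through its finite-dimensional distributions and its piecewise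
  constant paths, so neither a strong Markov property nor a martingale is at hand. Ottaviani's
  inequality fits: it uses transition probabilities along a finite grid, provided they are
  controlled uniformly in the starting configuration, and that is why the variance estimate is made
  for every start. The crude variance bound suffices because the supremum is cut into a number of
  pieces that does not depend on L: sites are sampled at a mesh of order L, times in windows of
  order L^2, and a piece fails with probability of order L / L^2 = 1 / L. The constant 2 of the
  source is half the largest squared jump. The kink of -|x - y| contributes -1 under half the
  discrete Laplacian in each coordinate, so the barrier cancels the source exactly.
  \<open>phi\<close> is given only as a classical solution, without a formula, and is reached by
  comparison alone. Positivity of the semigroup and both maximum principles rest on one device: add
  k t and inspect the minimum.\<close>

locale q_matrix =
  fixes S :: "'s set" and Q :: "'s \<Rightarrow> 's \<Rightarrow> real"
  assumes finite_states: "finite S"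
    and rate_nonneg: "\<And>a b. a \<in> S \<Longrightarrow> b \<in> S \<Longrightarrow> a \<noteq> b \<Longrightarrow> 0 \<le> Q a b"
    and rate_sum: "\<And>a. a \<in> S \<Longrightarrow> (\<Sum>b\<in>S. Q a b) = 0"
begin

text \<open>The total K of all absolute entries dominates every row sum, which suffices to compare
  the series of \<open>trans_prob\<close> with that of exp (K |t|).\<close>

lemma Qpow_bound:
  assumes "a \<in> S"
  shows "\<bar>Qpow S Q n a b\<bar> \<le> (\<Sum>a\<in>S. \<Sum>c\<in>S. \<bar>Q a c\<bar>) ^ n"
  using assms
proof (induction n arbitrary: a)
  case 0
  then show ?case by simp
next
  case (Suc n)
  let ?K = "\<Sum>a\<in>S. \<Sum>c\<in>S. \<bar>Q a c\<bar>"
  have "\<bar>Qpow S Q (Suc n) a b\<bar> \<le> (\<Sum>c\<in>S. \<bar>Q a c\<bar> * \<bar>Qpow S Q n c b\<bar>)"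
    by (simp add: sum_abs[THEN order_trans] abs_mult[symmetric])
  also have "\<dots> \<le> (\<Sum>c\<in>S. \<bar>Q a c\<bar> * ?K ^ n)"
    by (intro sum_mono mult_left_mono Suc.IH) auto
  also have "\<dots> = (\<Sum>c\<in>S. \<bar>Q a c\<bar>) * ?K ^ n"
    by (simp add: sum_distrib_right)
  also have "\<dots> \<le> ?K * ?K ^ n"
    using Suc.prems finite_states
    by (intro mult_right_mono member_le_sum[of a S "\<lambda>a. \<Sum>c\<in>S. \<bar>Q a c\<bar>"] zero_le_power)
       (auto intro!: sum_nonneg)
  finally show ?case by simp
qed

text \<open>\<open>Qpow\<close> recurses on the left factor, the form of the backward equation; the
  forward equation needs the last factor split off instead.\<close>

lemma Qpow_Suc_right:
  assumes "a \<in> S" "b \<in> S"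
  shows "Qpow S Q (Suc n) a b = (\<Sum>c\<in>S. Qpow S Q n a c * Q c b)"
  using assms(1)
proof (induction n arbitrary: a)
  case 0
  have "(\<Sum>c\<in>S. Q a c * (if c = b then 1 else 0)) = Q a b"
    using assms(2) finite_states sum.delta[of S b "\<lambda>c. Q a c"]
    by (simp add: if_distrib cong: if_cong)
  moreover have "(\<Sum>c\<in>S. (if a = c then 1 else 0) * Q c b) = Q a b"
    using 0 finite_states by (simp add: if_distrib[of "\<lambda>x. x * _"] cong: if_cong)
  ultimately show ?case by simp
next
  case (Suc n)
  have "Qpow S Q (Suc (Suc n)) a b = (\<Sum>c\<in>S. Q a c * (\<Sum>d\<in>S. Qpow S Q n c d * Q d b))"
    using Suc.IH by (subst Qpow.simps) (auto intro!: sum.cong)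
  also have "\<dots> = (\<Sum>d\<in>S. \<Sum>c\<in>S. Q a c * Qpow S Q n c d * Q d b)"
    by (subst sum.swap) (simp add: sum_distrib_left mult.assoc)
  also have "\<dots> = (\<Sum>d\<in>S. Qpow S Q (Suc n) a d * Q d b)"
    by (simp add: sum_distrib_right)
  finally show ?case .
qed

lemma Qpow_summable:
  assumes "a \<in> S"
  shows "summable (\<lambda>n. Qpow S Q n a b / fact n * t ^ n)"
proof (rule summable_comparison_test'[where N = 0])
  let ?K = "\<Sum>a\<in>S. \<Sum>c\<in>S. \<bar>Q a c\<bar>"
  show "summable (\<lambda>n. inverse (fact n) * (?K * \<bar>t\<bar>) ^ n)"
    by (rule summable_exp)
  show "norm (Qpow S Q n a b / fact n * t ^ n) \<le> inverse (fact n) * (?K * \<bar>t\<bar>) ^ n" for n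
    using mult_right_mono[OF Qpow_bound[OF assms, of n b], of "\<bar>t\<bar> ^ n / fact n"]
    by (simp add: abs_mult power_abs power_mult_distrib field_simps)
qed

lemma trans_prob_eq:
  "trans_prob S Q t a b = (\<Sum>n. Qpow S Q n a b / fact n * t ^ n)"
  unfolding trans_prob_def by (intro arg_cong[of _ _ suminf]) (auto simp: field_simps)

lemma diffs_Qpow: "diffs (\<lambda>n. Qpow S Q n a b / fact n) = (\<lambda>n. Qpow S Q (Suc n) a b / fact n)"
  by (auto simp: diffs_def fact_Suc simp del: Qpow.simps of_nat_Suc)

lemma trans_prob_deriv:
  assumes "a \<in> S"
  shows "((\<lambda>t. trans_prob S Q t a b) has_real_derivative
          (\<Sum>n. Qpow S Q (Suc n) a b / fact n * t ^ n)) (at t)"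
  using termdiffs_strong_converges_everywhere
    [of "\<lambda>n. Qpow S Q n a b / fact n" t, OF Qpow_summable[OF assms]]
  by (simp add: trans_prob_eq diffs_Qpow del: Qpow.simps)

text \<open>This equation moves the starting state and serves for positivity; its forward
  counterpart moves the target and yields the evolution of expectations.\<close>

lemma trans_prob_backward:
  assumes "a \<in> S"
  shows "((\<lambda>t. trans_prob S Q t a b) has_real_derivative
          (\<Sum>c\<in>S. Q a c * trans_prob S Q t c b)) (at t)"
proof -
  have "(\<Sum>n. Qpow S Q (Suc n) a b / fact n * t ^ n)
      = (\<Sum>n. \<Sum>c\<in>S. Q a c * (Qpow S Q n c b / fact n * t ^ n))"
    by (simp add: sum_divide_distrib sum_distrib_right mult.assoc)
  also have "\<dots> = (\<Sum>c\<in>S. \<Sum>n. Q a c * (Qpow S Q n c b / fact n * t ^ n))"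
    by (intro suminf_sum summable_mult Qpow_summable)
  also have "\<dots> = (\<Sum>c\<in>S. Q a c * trans_prob S Q t c b)"
    by (intro sum.cong refl) (simp only: trans_prob_eq suminf_mult[OF Qpow_summable])
  finally show ?thesis using trans_prob_deriv[OF assms, of b t] by simp
qed

lemma trans_prob_forward:
  assumes "a \<in> S" "b \<in> S"
  shows "((\<lambda>t. trans_prob S Q t a b) has_real_derivative
          (\<Sum>c\<in>S. trans_prob S Q t a c * Q c b)) (at t)"
proof -
  have "(\<Sum>n. Qpow S Q (Suc n) a b / fact n * t ^ n)
      = (\<Sum>n. \<Sum>c\<in>S. Q c b * (Qpow S Q n a c / fact n * t ^ n))"
    unfolding Qpow_Suc_right[OF assms] sum_divide_distrib sum_distrib_right
    by (simp add: mult_ac)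
  also have "\<dots> = (\<Sum>c\<in>S. \<Sum>n. Q c b * (Qpow S Q n a c / fact n * t ^ n))"
    by (intro suminf_sum summable_mult Qpow_summable assms)
  also have "\<dots> = (\<Sum>c\<in>S. trans_prob S Q t a c * Q c b)"
    by (intro sum.cong refl)
       (simp only: trans_prob_eq suminf_mult[OF Qpow_summable[OF assms(1)]], rule mult.commute)
  finally show ?thesis using trans_prob_deriv[OF assms(1), of b t] by simp
qed

lemma trans_prob_0: "trans_prob S Q 0 a b = (if a = b then 1 else 0)"
proof -
  have "(\<Sum>n. Qpow S Q n a b / fact n * 0 ^ n) = Qpow S Q 0 a b / fact 0"
    by (rule powser_zero)
  then show ?thesis by (simp add: trans_prob_eq)
qed

definition expec :: "real \<Rightarrow> ('s \<Rightarrow> real) \<Rightarrow> 's \<Rightarrow> real" where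
  "expec t f a = (\<Sum>b\<in>S. trans_prob S Q t a b * f b)"

lemma expec_cong: "(\<And>b. b \<in> S \<Longrightarrow> f b = g b) \<Longrightarrow> expec t f a = expec t g a"
  by (auto simp: expec_def intro!: sum.cong)

lemma expec_add: "expec t (\<lambda>b. f b + g b) a = expec t f a + expec t g a"
  by (simp add: expec_def distrib_left sum.distrib)

lemma expec_diff: "expec t (\<lambda>b. f b - g b) a = expec t f a - expec t g a"
  by (simp add: expec_def right_diff_distrib sum_subtractf)

lemma expec_cmult: "expec t (\<lambda>b. c * f b) a = c * expec t f a"
  by (simp add: expec_def sum_distrib_left mult_ac)

lemma expec_0:
  assumes "a \<in> S"
  shows "expec 0 f a = f a"
  using assms finite_states
  by (simp add: expec_def trans_prob_0 if_distrib[of "\<lambda>x. x * _"] cong: if_cong)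

text \<open>Dynkin's formula, from the forward equation. The image \<open>g\<close> of the generator
  is a separate function, so that closed formulas valid only on \<open>S\<close> can be
  inserted.\<close>

lemma expec_deriv:
  assumes "a \<in> S" and "\<And>b. b \<in> S \<Longrightarrow> (\<Sum>c\<in>S. Q b c * f c) = g b"
  shows "((\<lambda>t. expec t f a) has_real_derivative expec t g a) (at t)"
proof -
  have "((\<lambda>t. expec t f a) has_real_derivative
          (\<Sum>b\<in>S. (\<Sum>c\<in>S. trans_prob S Q t a c * Q c b) * f b)) (at t)"
    unfolding expec_def by (intro DERIV_sum DERIV_cmult_right trans_prob_forward assms(1))
  also have "(\<Sum>b\<in>S. (\<Sum>c\<in>S. trans_prob S Q t a c * Q c b) * f b) =
      (\<Sum>c\<in>S. \<Sum>b\<in>S. trans_prob S Q t a c * (Q c b * f b))"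
    by (subst sum.swap) (simp add: sum_distrib_right mult.assoc)
  also have "\<dots> = expec t g a"
    unfolding expec_def
    by (intro sum.cong refl) (simp add: assms(2)[symmetric] sum_distrib_left)
  finally show ?thesis .
qed

end

section \<open>A minimum principle for finite systems of differential inequalities\<close>

text \<open>Adding k t with a small k > 0 makes the inequality strict: at a negative minimum over
  all components and times the perturbed function would have derivative at least k, yet it cannot
  have been smaller just before. The condition concerns negative minima only, so that nonnegative
  boundary values automatically lie above the minimum.\<close>

lemma finite_min_principle:
  fixes v v' :: "'a \<Rightarrow> real \<Rightarrow> real"
  assumes fin: "finite A"
    and deriv: "\<And>a t. a \<in> A \<Longrightarrow> 0 \<le> t \<Longrightarrow> (v a has_real_derivative v' a t) (at t)"
    and init: "\<And>a. a \<in> A \<Longrightarrow> 0 \<le> v a 0"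
    and at_min: "\<And>a t. a \<in> A \<Longrightarrow> 0 < t \<Longrightarrow> (\<And>b. b \<in> A \<Longrightarrow> v a t \<le> v b t) \<Longrightarrow>
                  v a t < 0 \<Longrightarrow> 0 \<le> v' a t"
    and "a \<in> A" "0 \<le> t"
  shows "0 \<le> v a t"
proof (rule ccontr)
  assume neg: "\<not> 0 \<le> v a t"
  have "t \<noteq> 0" using neg init[OF \<open>a \<in> A\<close>] by auto
  then have "0 < t" using \<open>0 \<le> t\<close> by simp
  \<comment> \<open>With this slope the perturbation cancels half of the negative value, so the sum
    at time t stays negative.\<close>
  define k where "k = - v a t / (2 * t)"
  have k: "0 < k" "v a t + k * t < 0"
    using neg \<open>0 < t\<close> by (auto simp: k_def field_simps)
  define w where "w = (\<lambda>b s. v b s + k * s)"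
  have "\<exists>s\<in>{0..t}. \<forall>r\<in>{0..t}. w b s \<le> w b r" if "b \<in> A" for b
  proof (rule continuous_attains_inf)
    have "continuous_on {0..t} (v b)"
      by (rule DERIV_continuous_on[of _ _ "v' b"])
         (use deriv[OF that] in \<open>auto intro: has_field_derivative_at_within\<close>)
    then show "continuous_on {0..t} (w b)"
      unfolding w_def by (intro continuous_intros)
  qed (use \<open>0 \<le> t\<close> in auto)
  then obtain s where s: "\<And>b. b \<in> A \<Longrightarrow> s b \<in> {0..t}"
      "\<And>b r. b \<in> A \<Longrightarrow> r \<in> {0..t} \<Longrightarrow> w b (s b) \<le> w b r" by metis
  obtain b where b: "b \<in> A" "\<And>c. c \<in> A \<Longrightarrow> w b (s b) \<le> w c (s c)"
  proof -
    have "A \<noteq> {}" using \<open>a \<in> A\<close> by auto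
    from that[OF arg_min_if_finite(1)[OF fin this] arg_min_least[OF fin this]] show ?thesis
      by blast
  qed
  have least: "w b (s b) \<le> w c r" if "c \<in> A" "r \<in> {0..t}" for c r
    using b(2)[OF that(1)] s(2)[OF that] by linarith
  have wneg: "w b (s b) < 0" using least[OF \<open>a \<in> A\<close>, of t] k \<open>0 \<le> t\<close> by (simp add: w_def)
  have "s b \<noteq> 0" using wneg init[OF b(1)] by (auto simp: w_def)
  then have sb: "0 < s b" "s b \<le> t" using s(1)[OF b(1)] by auto
  have "v b (s b) \<le> v c (s b)" if "c \<in> A" for c
    using least[OF that, of "s b"] sb by (simp add: w_def)
  moreover have "v b (s b) < 0"
    using wneg k(1) sb mult_pos_pos[of k "s b"] unfolding w_def by linarith
  ultimately have "0 \<le> v' b (s b)" using at_min[OF b(1) sb(1)] by blast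
  moreover have "(w b has_real_derivative v' b (s b) + k) (at (s b))"
    unfolding w_def using deriv[OF b(1), of "s b"] sb
    by (auto intro!: derivative_eq_intros)
  ultimately obtain d where d: "d > 0" "\<And>e. 0 < e \<Longrightarrow> e < d \<Longrightarrow> w b (s b - e) < w b (s b)"
    using DERIV_pos_inc_left[of "w b" "v' b (s b) + k" "s b"] k by auto
  \<comment> \<open>The minimum is taken over [0, t], so the step back must not pass time
    zero.\<close>
  define e where "e = min (d/2) (s b)"
  have "w b (s b - e) < w b (s b)" using d sb by (auto simp: e_def)
  moreover have "w b (s b) \<le> w b (s b - e)"
    using sb d by (intro least b) (auto simp: e_def)
  ultimately show False by simp
qed

section \<open>Positivity and conservation of mass\<close>

context q_matrix
begin

text \<open>For a fixed target, the backward equation is a finite system in the starting state. Zero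
  row sums allow the minimal value to be subtracted, and then nonnegative off-diagonal rates act on
  nonnegative differences.\<close>

lemma trans_prob_nonneg:
  assumes "a \<in> S" "b \<in> S" "0 \<le> t"
  shows "0 \<le> trans_prob S Q t a b"
proof (rule finite_min_principle[where v = "\<lambda>a t. trans_prob S Q t a b"
      and v' = "\<lambda>a t. \<Sum>c\<in>S. Q a c * trans_prob S Q t c b" and A = S])
  fix a t assume a: "a \<in> S" and min: "\<And>c. c \<in> S \<Longrightarrow> trans_prob S Q t a b \<le> trans_prob S Q t c b"
  have "0 \<le> (\<Sum>c\<in>S. Q a c * (trans_prob S Q t c b - trans_prob S Q t a b))"
    using rate_nonneg[OF a] min
    by (intro sum_nonneg) (metis cancel_comm_monoid_add_class.diff_cancel diff_ge_0_iff_ge mult_nonneg_nonneg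
        mult_zero_right order_refl)
  also have "\<dots> = (\<Sum>c\<in>S. Q a c * trans_prob S Q t c b)"
    using rate_sum[OF a] by (simp add: right_diff_distrib sum_subtractf sum_distrib_right[symmetric])
  finally show "0 \<le> (\<Sum>c\<in>S. Q a c * trans_prob S Q t c b)" .
qed (use assms finite_states in \<open>auto simp: trans_prob_0 intro!: trans_prob_backward\<close>)

lemma expec_mono:
  assumes "a \<in> S" "0 \<le> t" "\<And>b. b \<in> S \<Longrightarrow> f b \<le> g b"
  shows "expec t f a \<le> expec t g a"
  unfolding expec_def using assms by (intro sum_mono mult_left_mono trans_prob_nonneg)

text \<open>Zero row sums make the generator annihilate constants, so the transition probabilities
  out of a state sum to one.\<close>

lemma expec_const:
  assumes "a \<in> S"
  shows "expec t (\<lambda>_. c) a = c"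
proof -
  have "((\<lambda>t. expec t (\<lambda>_. c) a) has_real_derivative expec t (\<lambda>_. 0) a) (at t)" for t
    by (rule expec_deriv[OF assms]) (simp add: sum_distrib_right[symmetric] rate_sum)
  then have "expec t (\<lambda>_. c) a = expec 0 (\<lambda>_. c) a"
    by (intro DERIV_isconst_all) (auto simp: expec_def[of _ "\<lambda>_. 0"])
  then show ?thesis by (simp add: expec_0[OF assms])
qed

text \<open>Phrased with transition sums rather than with the process, so that it applies from every
  starting state, as the maximal inequality requires.\<close>

lemma trans_prob_chebyshev:
  assumes "a \<in> S" "0 \<le> t" "0 < r"
  shows "(\<Sum>b | b \<in> S \<and> r \<le> \<bar>f b - m\<bar>. trans_prob S Q t a b) \<le> expec t (\<lambda>b. (f b - m)\<^sup>2) a / r\<^sup>2"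
proof -
  have "(\<Sum>b | b \<in> S \<and> r \<le> \<bar>f b - m\<bar>. trans_prob S Q t a b)
      = expec t (\<lambda>b. if r \<le> \<bar>f b - m\<bar> then 1 else 0) a"
    unfolding expec_def using finite_states
    by (intro sum.mono_neutral_cong_left) auto
  also have "\<dots> \<le> expec t (\<lambda>b. inverse (r\<^sup>2) * (f b - m)\<^sup>2) a"
  proof (rule expec_mono[OF assms(1,2)])
    fix b
    have "r\<^sup>2 \<le> (f b - m)\<^sup>2" if "r \<le> \<bar>f b - m\<bar>"
      using that assms(3) by (simp add: abs_le_square_iff[symmetric])
    then show "(if r \<le> \<bar>f b - m\<bar> then 1 else 0) \<le> inverse (r\<^sup>2) * (f b - m)\<^sup>2"
      using assms(3) by (auto simp: field_simps)
  qed
  also have "\<dots> = expec t (\<lambda>b. (f b - m)\<^sup>2) a / r\<^sup>2"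
    by (simp add: expec_cmult divide_inverse mult.commute)
  finally show ?thesis .
qed

end

section \<open>Mean and covariance of the corner-flip dynamics\<close>

lemma Omega_step:
  assumes "h \<in> Omega M N" "x < M + N"
  shows "h (Suc x) = h x + 1 \<or> h (Suc x) = h x - 1"
  using assms by (auto simp: Omega_def abs_if split: if_splits)

lemma Omega_lipschitz:
  assumes h: "h \<in> Omega M N" and "x \<le> M + N" "y \<le> M + N"
  shows "\<bar>h x - h y\<bar> \<le> \<bar>int x - int y\<bar>"
proof -
  have *: "\<bar>h (x + d) - h x\<bar> \<le> int d" if "x + d \<le> M + N" for x d
    using that
  proof (induction d)
    case (Suc d)
    then show ?case using Omega_step[OF h, of "x + d"] by fastforce
  qed simp
  show ?thesis
  proof (cases "x \<le> y")
    case True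
    then show ?thesis using *[of x "y - x"] assms by (simp add: abs_minus_commute)
  next
    case False
    then show ?thesis using *[of y "x - y"] assms by simp
  qed
qed

text \<open>Heights are bounded by M + N in absolute value, and the value 0 beyond the last site
  leaves only finitely many coordinates free.\<close>

lemma finite_Omega: "finite (Omega M N)"
proof (rule finite_subset)
  show "Omega M N \<subseteq> {h. \<forall>x. (x \<in> {..M+N} \<longrightarrow> h x \<in> {- int (M+N)..int (M+N)}) \<and> (x \<notin> {..M+N} \<longrightarrow> h x = 0)}"
  proof
    fix h assume h: "h \<in> Omega M N"
    have "\<bar>h x\<bar> \<le> int x" if "x \<le> M + N" for x
      using Omega_lipschitz[OF h that, of 0] h by (simp add: Omega_def)
    then have "h x \<in> {- int (M+N)..int (M+N)}" if "x \<le> M + N" for x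
      using that by (fastforce simp: abs_le_iff)
    then show "h \<in> {h. \<forall>x. (x \<in> {..M+N} \<longrightarrow> h x \<in> {- int (M+N)..int (M+N)}) \<and> (x \<notin> {..M+N} \<longrightarrow> h x = 0)}"
      using h by (simp add: Omega_def)
  qed
qed (intro finite_set_of_finite_funs; simp)

section \<open>Corner flips and their generator\<close>

lemma flip_neq [simp]: "y \<noteq> x \<Longrightarrow> flip h x y = h y"
  by (simp add: flip_def)

text \<open>The discrete Laplacian is -2 at a peak, 2 at a valley and 0 on a slope, exactly the
  change made by a flip. This linearity closes the equations for means and covariances.\<close>

lemma flip_eq:
  assumes "h \<in> Omega M N" "x \<in> {1..<M+N}"
  shows "flip h x x - h x = h (x + 1) + h (x - 1) - 2 * h x"
proof -
  have "x - 1 < M + N" "x < M + N" "Suc (x - 1) = x" using assms(2) by auto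
  then show ?thesis
    using Omega_step[OF assms(1), of x] Omega_step[OF assms(1), of "x - 1"]
    by (auto simp: flip_def)
qed

lemma flip_jump_bound: "\<bar>flip h x x - h x\<bar> \<le> 2"
  by (auto simp: flip_def)

lemma flip_in_Omega:
  assumes h: "h \<in> Omega M N" and x: "x \<in> {1..<M+N}"
  shows "flip h x \<in> Omega M N"
proof -
  have "\<bar>flip h x (Suc y) - flip h x y\<bar> = 1" if "y < M + N" for y
  proof -
    consider "y = x" | "Suc y = x" | "y \<noteq> x" "Suc y \<noteq> x" by blast
    then show ?thesis
      using Omega_step[OF h that] by cases (auto simp: flip_def)
  qed
  then show ?thesis using h x by (auto simp: Omega_def)
qed

text \<open>Grouping the flips by their outcome turns the sum over target states into a sum over
  sites; flips that change nothing cancel against the diagonal.\<close>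

lemma cf_rate_apply:
  assumes a: "a \<in> Omega M N"
  shows "(\<Sum>b\<in>Omega M N. cf_rate (M + N) a b * f b)
       = (1/2) * (\<Sum>x\<in>{1..<M+N}. f (flip a x) - f a)"
proof -
  have "(\<Sum>b\<in>Omega M N. cf_rate (M + N) a b * f b)
      = (\<Sum>b\<in>Omega M N. (1/2) * (real (card {x \<in> {1..<M+N}. flip a x = b}) * f b))
        - (\<Sum>b\<in>Omega M N. if a = b then (1/2) * real (card {1..<M+N}) * f b else 0)"
    by (simp add: cf_rate_def left_diff_distrib sum_subtractf if_distrib[of "\<lambda>x. x * _"] cong: if_cong)
  also have "(\<Sum>b\<in>Omega M N. if a = b then (1/2) * real (card {1..<M+N}) * f b else 0)
      = (1/2) * (\<Sum>x\<in>{1..<M+N}. f a)"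
    using a finite_Omega by simp
  also have "(\<Sum>b\<in>Omega M N. (1/2) * (real (card {x \<in> {1..<M+N}. flip a x = b}) * f b))
      = (1/2) * (\<Sum>b\<in>Omega M N. \<Sum>x | x \<in> {1..<M+N} \<and> flip a x = b. f (flip a x))"
    unfolding sum_distrib_left by (intro sum.cong refl) (simp add: sum_distrib_left[symmetric])
  also have "(\<Sum>b\<in>Omega M N. \<Sum>x | x \<in> {1..<M+N} \<and> flip a x = b. f (flip a x))
      = (\<Sum>x\<in>{1..<M+N}. f (flip a x))"
    using flip_in_Omega[OF a] by (intro sum.group finite_Omega) auto
  finally show ?thesis by (simp add: sum_subtractf right_diff_distrib)
qed

lemma q_matrix_corner_flip: "q_matrix (Omega M N) (cf_rate (M + N))"
proof
  show "(\<Sum>b\<in>Omega M N. cf_rate (M + N) a b) = 0" if "a \<in> Omega M N" for a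
    using cf_rate_apply[OF that, of "\<lambda>_. 1"] by simp
qed (auto simp: finite_Omega cf_rate_def)

lemma generator_height:
  assumes h: "h \<in> Omega M N" and x: "x \<in> {1..<M+N}"
  shows "(\<Sum>b\<in>Omega M N. cf_rate (M + N) h b * real_of_int (b x))
       = (real_of_int (h (x + 1)) + real_of_int (h (x - 1)) - 2 * real_of_int (h x)) / 2"
proof -
  have "(\<Sum>z\<in>{1..<M+N}. real_of_int (flip h z x) - real_of_int (h x))
      = (\<Sum>z\<in>{1..<M+N}. if z = x then real_of_int (flip h x x - h x) else 0)"
    by (intro sum.cong) auto
  also have "\<dots> = real_of_int (flip h x x - h x)"
    using x by simp
  finally show ?thesis
    using cf_rate_apply[OF h, of "\<lambda>b. real_of_int (b x)"] by (simp add: flip_eq[OF h x])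
qed

text \<open>A product rule with a correction: one flip changes one height, so both factors move
  together only when x = y, and then the square of the jump remains.\<close>

lemma generator_height_product:
  assumes h: "h \<in> Omega M N" and x: "x \<in> {1..<M+N}" and y: "y \<in> {1..<M+N}"
  defines "d \<equiv> \<lambda>x. real_of_int (h (x + 1)) + real_of_int (h (x - 1)) - 2 * real_of_int (h x)"
  shows "(\<Sum>b\<in>Omega M N. cf_rate (M + N) h b * (real_of_int (b x) * real_of_int (b y)))
       = (d x * real_of_int (h y) + real_of_int (h x) * d y + (if x = y then (d x)\<^sup>2 else 0)) / 2"
proof -
  have d: "d z = real_of_int (flip h z z) - real_of_int (h z)" if "z \<in> {1..<M+N}" for z
    using arg_cong[OF flip_eq[OF h that], of real_of_int] by (simp add: d_def)
  have "(\<Sum>z\<in>{1..<M+N}. real_of_int (flip h z x) * real_of_int (flip h z y)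
              - real_of_int (h x) * real_of_int (h y))
      = (\<Sum>z\<in>{1..<M+N}. (if z = x then d x * real_of_int (h y) else 0)
          + (if z = y then real_of_int (h x) * d y else 0)
          + (if z = x then if x = y then (d x)\<^sup>2 else 0 else 0))"
    using x y by (intro sum.cong) (auto simp: d algebra_simps power2_eq_square)
  also have "\<dots> = d x * real_of_int (h y) + real_of_int (h x) * d y + (if x = y then (d x)\<^sup>2 else 0)"
    using x y by (simp add: sum.distrib)
  finally show ?thesis
    using cf_rate_apply[OF h, of "\<lambda>b. real_of_int (b x) * real_of_int (b y)"] by simp
qed

lemma discrete_heat_min_principle:
  fixes v v' :: "nat \<Rightarrow> real \<Rightarrow> real"
  assumes deriv: "\<And>x t. x \<in> {1..<L} \<Longrightarrow> 0 \<le> t \<Longrightarrow> (v x has_real_derivative v' x t) (at t)"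
    and super: "\<And>x t. x \<in> {1..<L} \<Longrightarrow> 0 \<le> t \<Longrightarrow> (v (x + 1) t + v (x - 1) t - 2 * v x t) / 2 \<le> v' x t"
    and init: "\<And>x. x \<le> L \<Longrightarrow> 0 \<le> v x 0"
    and bdry: "\<And>t. 0 \<le> t \<Longrightarrow> 0 \<le> v 0 t" "\<And>t. 0 \<le> t \<Longrightarrow> 0 \<le> v L t"
    and "x \<le> L" "0 \<le> t"
  shows "0 \<le> v x t"
proof (cases "x \<in> {1..<L}")
  case True
  show ?thesis
  proof (rule finite_min_principle[of "{1..<L}" v v'])
    fix a t
    assume a: "a \<in> {1..<L}" and t: "0 < t" and min: "\<And>b. b \<in> {1..<L} \<Longrightarrow> v a t \<le> v b t"
      and neg: "v a t < 0"
    have "v a t \<le> v b t" if "b \<le> L" for b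
      using min[of b] neg bdry[of t] t that by (cases "b = 0 \<or> b = L") auto
    moreover have "a + 1 \<le> L" "a - 1 \<le> L" using a by auto
    ultimately have "v a t \<le> v (a + 1) t" "v a t \<le> v (a - 1) t" by blast+
    then have "0 \<le> (v (a + 1) t + v (a - 1) t - 2 * v a t) / 2" by simp
    also have "\<dots> \<le> v' a t" using super[OF a] t by simp
    finally show "0 \<le> v' a t" .
  qed (use assms True in auto)
next
  case False
  then have "x = 0 \<or> x = L" using \<open>x \<le> L\<close> by auto
  then show ?thesis using bdry \<open>0 \<le> t\<close> by auto
qed

section \<open>Mean heights and their displacement\<close>

locale corner_flip =
  fixes M N L :: nat
  defines "L \<equiv> M + N"
begin

sublocale q_matrix "Omega M N" "cf_rate (M + N)"
  by (rule q_matrix_corner_flip)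

definition mean :: "(nat \<Rightarrow> int) \<Rightarrow> nat \<Rightarrow> real \<Rightarrow> real" where
  "mean \<xi> x t = expec t (\<lambda>b. real_of_int (b x)) \<xi>"

lemma mean_0: "\<xi> \<in> Omega M N \<Longrightarrow> mean \<xi> x 0 = real_of_int (\<xi> x)"
  by (simp add: mean_def expec_0)

lemma expec_fixed:
  assumes "\<xi> \<in> Omega M N" "\<And>b. b \<in> Omega M N \<Longrightarrow> f b = c"
  shows "expec t f \<xi> = c"
  using expec_const[OF assms(1), of t c] expec_cong[of f "\<lambda>_. c" t \<xi>] assms(2) by simp

lemma mean_left: "\<xi> \<in> Omega M N \<Longrightarrow> mean \<xi> 0 t = 0"
  unfolding mean_def by (rule expec_fixed) (auto simp: Omega_def)

lemma mean_right: "\<xi> \<in> Omega M N \<Longrightarrow> mean \<xi> L t = real_of_int (\<xi> L)"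
  unfolding mean_def by (rule expec_fixed) (auto simp: Omega_def L_def)

lemma mean_deriv:
  assumes "\<xi> \<in> Omega M N" "x \<in> {1..<L}"
  shows "(mean \<xi> x has_real_derivative
          (mean \<xi> (x + 1) t + mean \<xi> (x - 1) t - 2 * mean \<xi> x t) / 2) (at t)"
proof -
  have "(mean \<xi> x has_real_derivative expec t (\<lambda>h. (real_of_int (h (x + 1)) +
      real_of_int (h (x - 1)) - 2 * real_of_int (h x)) / 2) \<xi>) (at t)"
    unfolding mean_def[abs_def] using assms
    by (intro expec_deriv generator_height) (auto simp: L_def)
  also have "expec t (\<lambda>h. (real_of_int (h (x + 1)) +
      real_of_int (h (x - 1)) - 2 * real_of_int (h x)) / 2) \<xi>
      = expec t (\<lambda>h. (1/2) * (real_of_int (h (x + 1)) +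
      real_of_int (h (x - 1)) - 2 * real_of_int (h x))) \<xi>"
    by simp
  also have "\<dots> = (mean \<xi> (x + 1) t + mean \<xi> (x - 1) t - 2 * mean \<xi> x t) / 2"
    unfolding mean_def by (simp only: expec_cmult expec_diff expec_add)
  finally show ?thesis .
qed

text \<open>
  The profile is 1-Lipschitz and \<open>\<bar>z\<bar> \<le> z\<^sup>2 / (2 A) + A / 2\<close>; the quadratic majorant evolves explicitly
  under the discrete heat equation, by adding \<open>t / (2 A)\<close>.
\<close>

lemma mean_displacement_aux:
  assumes xi: "\<xi> \<in> Omega M N" and x: "x \<le> L" and t: "0 \<le> t" and A: "0 < A"
    and s: "s \<in> {-1, 1}"
  shows "s * (mean \<xi> x t - real_of_int (\<xi> x)) \<le> A / 2 + t / (2 * A)"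
proof -
  define k where "k = 1 / (2 * A)"
  have k: "0 < k" using A by (simp add: k_def)
  define w where "w y t = k * (real y - real x)\<^sup>2 + A / 2 + k * t
      - s * (mean \<xi> y t - real_of_int (\<xi> x))" for y t
  have bound: "s * (real_of_int (\<xi> y) - real_of_int (\<xi> x)) \<le> k * (real y - real x)\<^sup>2 + A / 2" if "y \<le> L" for y
  proof -
    have "s * (real_of_int (\<xi> y) - real_of_int (\<xi> x)) \<le> \<bar>real_of_int (\<xi> y - \<xi> x)\<bar>"
      using s by (auto simp: abs_if)
    also have "\<dots> \<le> \<bar>real y - real x\<bar>"
    proof -
      have "real_of_int \<bar>\<xi> y - \<xi> x\<bar> \<le> real_of_int \<bar>int y - int x\<bar>"
        using Omega_lipschitz[OF xi, of y x] that x unfolding L_def of_int_le_iff by simp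
      then show ?thesis by simp
    qed
    also have "\<dots> \<le> k * (real y - real x)\<^sup>2 + A / 2"
    proof -
      have "0 \<le> (\<bar>real y - real x\<bar> - A)\<^sup>2" by simp
      then have "2 * A * \<bar>real y - real x\<bar> \<le> (real y - real x)\<^sup>2 + A\<^sup>2"
        by (simp add: power2_diff mult_ac)
      then show ?thesis using A unfolding k_def by (simp add: field_simps power2_eq_square)
    qed
    finally show ?thesis .
  qed
  have "0 \<le> w x t"
  proof (rule discrete_heat_min_principle[of L w
        "\<lambda>y t. k - s * ((mean \<xi> (y + 1) t + mean \<xi> (y - 1) t - 2 * mean \<xi> y t) / 2)"])
    fix y t assume y: "y \<in> {1..<L}"
    show "(w y has_real_derivative
        k - s * ((mean \<xi> (y + 1) t + mean \<xi> (y - 1) t - 2 * mean \<xi> y t) / 2)) (at t)"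
      unfolding w_def[abs_def]
      by (rule derivative_eq_intros mean_deriv[OF xi y] refl)+ simp
    have r: "real (y + 1) = real y + 1" "real (y - 1) = real y - 1" using y by auto
    have "(real (y + 1) - real x)\<^sup>2 = 2 * (real y - real x)\<^sup>2 + 2 - (real (y - 1) - real x)\<^sup>2"
      unfolding r by (simp add: power2_eq_square algebra_simps)
    from arg_cong[OF this, of "\<lambda>z. k * z"]
    have "k * (real (y + 1) - real x)\<^sup>2 = 2 * (k * (real y - real x)\<^sup>2) + 2 * k - k * (real (y - 1) - real x)\<^sup>2"
      by (simp add: algebra_simps)
    moreover have "(a1 + B + T - s * (m1 - c) + (a2 + B + T - s * (m2 - c)) - 2 * (a + B + T - s * (m - c))) / 2
        \<le> k - s * ((m1 + m2 - 2 * m) / 2)"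
      if "a1 = 2 * a + 2 * k - a2" for a a1 a2 B T m m1 m2 c :: real
      unfolding that by (simp add: field_simps)
    ultimately show "(w (y + 1) t + w (y - 1) t - 2 * w y t) / 2
       \<le> k - s * ((mean \<xi> (y + 1) t + mean \<xi> (y - 1) t - 2 * mean \<xi> y t) / 2)"
      unfolding w_def by blast
  next
    fix y assume "y \<le> L"
    from bound[OF this] show "0 \<le> w y 0" unfolding w_def by (simp add: mean_0[OF xi])
  next
    fix t :: real assume t: "0 \<le> t"
    have w: "0 \<le> w y t" if "y \<le> L" "mean \<xi> y t = real_of_int (\<xi> y)" for y
      using bound[OF that(1)] mult_nonneg_nonneg[of k t] k t unfolding w_def that(2) by linarith
    show "0 \<le> w 0 t" using xi by (intro w) (auto simp: mean_left Omega_def)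
    show "0 \<le> w L t" using xi by (intro w) (auto simp: mean_right)
  qed (use x t in auto)
  then show ?thesis by (simp add: w_def k_def)
qed

lemma mean_displacement:
  assumes "\<xi> \<in> Omega M N" "x \<le> L" "0 \<le> t" "0 < A"
  shows "\<bar>mean \<xi> x t - real_of_int (\<xi> x)\<bar> \<le> A / 2 + t / (2 * A)"
  using mean_displacement_aux[OF assms, of 1] mean_displacement_aux[OF assms, of "-1"] by auto

section \<open>Covariances and the variance bound\<close>

definition covar :: "(nat \<Rightarrow> int) \<Rightarrow> nat \<Rightarrow> nat \<Rightarrow> real \<Rightarrow> real" where
  "covar \<xi> x y t = expec t (\<lambda>b. real_of_int (b x) * real_of_int (b y)) \<xi> - mean \<xi> x t * mean \<xi> y t"

text \<open>All profiles of the state space have the same heights at 0 and \<open>L\<close>, so such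
  a factor is constant and leaves the expectation.\<close>

lemma covar_boundary:
  assumes xi: "\<xi> \<in> Omega M N" and "x \<in> {0, L} \<or> y \<in> {0, L}"
  shows "covar \<xi> x y t = 0"
proof -
  have fixed: "real_of_int (b z) = mean \<xi> z t" if "b \<in> Omega M N" "z \<in> {0, L}" for b z
    using that xi mean_left[OF xi] mean_right[OF xi] by (auto simp: Omega_def L_def)
  have "expec t (\<lambda>b. real_of_int (b x) * real_of_int (b y)) \<xi> = mean \<xi> x t * mean \<xi> y t"
    using assms(2)
  proof
    assume "x \<in> {0, L}"
    then have "expec t (\<lambda>b. real_of_int (b x) * real_of_int (b y)) \<xi>
        = expec t (\<lambda>b. mean \<xi> x t * real_of_int (b y)) \<xi>"
      by (intro expec_cong) (simp add: fixed)
    then show ?thesis by (simp only: expec_cmult mean_def[symmetric])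
  next
    assume "y \<in> {0, L}"
    then have "expec t (\<lambda>b. real_of_int (b x) * real_of_int (b y)) \<xi>
        = expec t (\<lambda>b. mean \<xi> y t * real_of_int (b x)) \<xi>"
      by (intro expec_cong) (simp add: fixed mult.commute)
    also have "\<dots> = mean \<xi> y t * mean \<xi> x t" by (simp only: expec_cmult mean_def[symmetric])
    finally show ?thesis by (simp only: mult.commute)
  qed
  then show ?thesis by (simp add: covar_def)
qed

text \<open>The Laplacian terms of the product generator and of the product of means combine into
  covariances; what survives is the expected squared jump on the diagonal, halved by the flip
  rate.\<close>

lemma covar_deriv:
  assumes xi: "\<xi> \<in> Omega M N" and x: "x \<in> {1..<L}" and y: "y \<in> {1..<L}"
  shows "(covar \<xi> x y has_real_derivative
          (covar \<xi> (x + 1) y t + covar \<xi> (x - 1) y t - 2 * covar \<xi> x y t) / 2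
        + (covar \<xi> x (y + 1) t + covar \<xi> x (y - 1) t - 2 * covar \<xi> x y t) / 2
        + (if x = y then expec t (\<lambda>b. (real_of_int (b (x + 1)) + real_of_int (b (x - 1))
              - 2 * real_of_int (b x))\<^sup>2) \<xi> / 2 else 0)) (at t)"
proof -
  define d where "d b x = real_of_int (b (x + 1)) + real_of_int (b (x - 1)) - 2 * real_of_int (b x)"
    for b :: "nat \<Rightarrow> int" and x
  define E where "E x y = expec t (\<lambda>b. real_of_int (b x) * real_of_int (b y)) \<xi>" for x y
  define D where "D = (if x = y then expec t (\<lambda>b. (d b x)\<^sup>2) \<xi> / 2 else 0)"
  have "((\<lambda>t. expec t (\<lambda>b. real_of_int (b x) * real_of_int (b y)) \<xi>) has_real_derivative
      expec t (\<lambda>h. (d h x * real_of_int (h y) + real_of_int (h x) * d h y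
          + (if x = y then (d h x)\<^sup>2 else 0)) / 2) \<xi>) (at t)"
    unfolding d_def using x y by (intro expec_deriv xi generator_height_product) (auto simp: L_def)
  also have "expec t (\<lambda>h. (d h x * real_of_int (h y) + real_of_int (h x) * d h y
          + (if x = y then (d h x)\<^sup>2 else 0)) / 2) \<xi>
     = expec t (\<lambda>h. (1/2) * (real_of_int (h (x + 1)) * real_of_int (h y)
          + real_of_int (h (x - 1)) * real_of_int (h y)
          - 2 * (real_of_int (h x) * real_of_int (h y))
          + (real_of_int (h x) * real_of_int (h (y + 1))
          + real_of_int (h x) * real_of_int (h (y - 1))
          - 2 * (real_of_int (h x) * real_of_int (h y))))
          + (if x = y then 1/2 else 0) * (d h x)\<^sup>2) \<xi>"
    by (intro expec_cong) (simp add: d_def field_simps)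
  also have "\<dots> = (1/2) * (E (x + 1) y + E (x - 1) y - 2 * E x y
        + (E x (y + 1) + E x (y - 1) - 2 * E x y)) + D"
    unfolding expec_add expec_cmult expec_diff E_def D_def by simp
  finally have "(covar \<xi> x y has_real_derivative
      (1/2) * (E (x + 1) y + E (x - 1) y - 2 * E x y + (E x (y + 1) + E x (y - 1) - 2 * E x y)) + D
      - ((mean \<xi> (x + 1) t + mean \<xi> (x - 1) t - 2 * mean \<xi> x t) / 2 * mean \<xi> y t
        + mean \<xi> x t * ((mean \<xi> (y + 1) t + mean \<xi> (y - 1) t - 2 * mean \<xi> y t) / 2))) (at t)"
    unfolding covar_def[abs_def]
    by (auto intro!: derivative_eq_intros mean_deriv[OF xi x] mean_deriv[OF xi y])
  then show ?thesis
    unfolding d_def[symmetric] D_def[symmetric] covar_def E_def[symmetric]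
    by (rule DERIV_cong) (simp add: field_simps)
qed

text \<open>In the proof \<open>v\<close> is the barrier minus the covariance. It starts nonnegative
  because the initial profile is deterministic, and it is nonnegative on the boundary, where
  covariances vanish. At a negative interior minimum, the neighbour inequalities bound the
  Laplacians of the covariance by those of the barrier.\<close>

lemma covar_bound:
  assumes xi: "\<xi> \<in> Omega M N" and x: "x \<le> L" and y: "y \<le> L" and t: "0 \<le> t"
  shows "covar \<xi> x y t \<le> real L - \<bar>real x - real y\<bar>"
proof (cases "x \<in> {1..<L} \<and> y \<in> {1..<L}")
  case False
  then have "x \<in> {0, L} \<or> y \<in> {0, L}" using x y by auto
  then show ?thesis using covar_boundary[OF xi, of x y t] x y by auto
next
  case True
  define v where "v = (\<lambda>(x, y) t. real L - \<bar>real x - real y\<bar> - covar \<xi> x y t)"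
  define C where "C x y t = (covar \<xi> (x + 1) y t + covar \<xi> (x - 1) y t - 2 * covar \<xi> x y t) / 2
        + (covar \<xi> x (y + 1) t + covar \<xi> x (y - 1) t - 2 * covar \<xi> x y t) / 2
        + (if x = y then expec t (\<lambda>b. (real_of_int (b (x + 1)) + real_of_int (b (x - 1))
              - 2 * real_of_int (b x))\<^sup>2) \<xi> / 2 else 0)" for x y t
  have "0 \<le> v (x, y) t"
  proof (rule finite_min_principle[of "{1..<L} \<times> {1..<L}" v "\<lambda>(x, y) t. - C x y t"])
    fix p t assume "p \<in> {1..<L} \<times> {1..<L}"
    then show "(v p has_real_derivative (\<lambda>(x, y) t. - C x y t) p t) (at t)"
      unfolding v_def C_def by (auto intro!: derivative_eq_intros covar_deriv[OF xi])
  next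
    fix p assume "p \<in> {1..<L} \<times> {1..<L}"
    then show "0 \<le> v p 0" by (auto simp: v_def covar_def mean_0[OF xi] expec_0[OF xi])
  next
    fix p t assume "p \<in> {1..<L} \<times> {1..<L}" and t: "0 < t"
      and min: "\<And>q. q \<in> {1..<L} \<times> {1..<L} \<Longrightarrow> v p t \<le> v q t" and neg: "v p t < 0"
    then obtain x y where p: "p = (x, y)" and x: "x \<in> {1..<L}" and y: "y \<in> {1..<L}" by auto
    have min': "v (x, y) t \<le> v (x', y') t" if "x' \<le> L" "y' \<le> L" for x' y'
    proof (cases "x' \<in> {1..<L} \<and> y' \<in> {1..<L}")
      case True
      then show ?thesis using min p by auto
    next
      case False
      then have "x' \<in> {0, L} \<or> y' \<in> {0, L}" using that by auto
      from covar_boundary[OF xi this, of t] have "0 \<le> v (x', y') t" using that by (auto simp: v_def)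
      then show ?thesis using neg p by simp
    qed
    have "expec t (\<lambda>b. (real_of_int (b (x + 1)) + real_of_int (b (x - 1)) - 2 * real_of_int (b x))\<^sup>2) \<xi>
        \<le> expec t (\<lambda>b. 4) \<xi>"
    proof (rule expec_mono[OF xi])
      fix b assume b: "b \<in> Omega M N"
      have "\<bar>real_of_int (flip b x x - b x)\<bar> \<le> 2"
        using flip_jump_bound[of b x] by linarith
      moreover have "real_of_int (flip b x x - b x)
          = real_of_int (b (x + 1)) + real_of_int (b (x - 1)) - 2 * real_of_int (b x)"
        using flip_eq[OF b, of x] x by (simp add: L_def)
      ultimately show "(real_of_int (b (x + 1)) + real_of_int (b (x - 1)) - 2 * real_of_int (b x))\<^sup>2 \<le> 4"
        using power_mono[of "\<bar>real_of_int (flip b x x - b x)\<bar>" 2 2] by (simp only: power2_abs) simp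
    qed (use t in auto)
    then have E: "expec t (\<lambda>b. (real_of_int (b (x + 1)) + real_of_int (b (x - 1)) - 2 * real_of_int (b x))\<^sup>2) \<xi> \<le> 4"
      by (simp add: expec_const[OF xi])
    have r: "real (x + 1) = real x + 1" "real (x - 1) = real x - 1"
      "real (y + 1) = real y + 1" "real (y - 1) = real y - 1" using x y by auto
    \<comment> \<open>The absolute value has its kink on the diagonal; off it the two neighbours
      average out exactly.\<close>
    have dist: "\<bar>real (x + 1) - real y\<bar> + \<bar>real (x - 1) - real y\<bar> = 2 * \<bar>real x - real y\<bar> + (if x = y then 2 else 0)"
      "\<bar>real x - real (y + 1)\<bar> + \<bar>real x - real (y - 1)\<bar> = 2 * \<bar>real x - real y\<bar> + (if x = y then 2 else 0)"
      unfolding r by (cases x y rule: linorder_cases; auto)+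
    have nb: "v (x, y) t \<le> v (x + 1, y) t" "v (x, y) t \<le> v (x - 1, y) t"
      "v (x, y) t \<le> v (x, y + 1) t" "v (x, y) t \<le> v (x, y - 1) t"
      using x y by (auto intro!: min')
    \<comment> \<open>Here \<open>m\<close> is the kink, 2 on the diagonal and 0 elsewhere, and
      \<open>e\<close> is the source. Each coordinate contributes at most -m / 2, so e \<le> m
      suffices.\<close>
    have sum_le: "(c1 + c2 - 2 * c) / 2 + (c3 + c4 - 2 * c) / 2 + e \<le> 0"
      if "e \<le> m" "d1 + d2 = 2 * d + m" "d3 + d4 = 2 * d + m" "l - d - c \<le> l - d1 - c1"
        "l - d - c \<le> l - d2 - c2" "l - d - c \<le> l - d3 - c3" "l - d - c \<le> l - d4 - c4"
      for c c1 c2 c3 c4 d d1 d2 d3 d4 e l m :: real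
      using that by argo
    have "C x y t \<le> 0"
      unfolding C_def using E by (intro sum_le[OF _ dist nb[unfolded v_def prod.case]]) auto
    then show "0 \<le> (\<lambda>(x, y) t. - C x y t) p t" using p by simp
  qed (use True t in auto)
  then show ?thesis by (simp add: v_def)
qed

lemma variance_bound:
  assumes "\<xi> \<in> Omega M N" "x \<le> L" "0 \<le> t"
  shows "expec t (\<lambda>b. (real_of_int (b x) - mean \<xi> x t)\<^sup>2) \<xi> \<le> real L"
proof -
  have "expec t (\<lambda>b. (real_of_int (b x) - mean \<xi> x t)\<^sup>2) \<xi>
      = expec t (\<lambda>b. real_of_int (b x) * real_of_int (b x)
          - (2 * mean \<xi> x t) * real_of_int (b x) + (mean \<xi> x t)\<^sup>2) \<xi>"
    by (intro expec_cong) (simp add: power2_eq_square algebra_simps)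
  also have "\<dots> = covar \<xi> x x t"
    unfolding expec_add expec_diff expec_cmult expec_const[OF assms(1)] covar_def mean_def
    by (simp add: power2_eq_square)
  also have "\<dots> \<le> real L" using covar_bound[OF assms(1,2,2,3)] by simp
  finally show ?thesis .
qed

lemma mean_deviation:
  assumes "\<xi> \<in> Omega M N" "x \<le> L" "0 \<le> t" "0 < r"
  shows "(\<Sum>b | b \<in> Omega M N \<and> r \<le> \<bar>real_of_int (b x) - mean \<xi> x t\<bar>.
            trans_prob (Omega M N) (cf_rate (M + N)) t \<xi> b) \<le> real L / r\<^sup>2"
  using trans_prob_chebyshev[OF assms(1,3,4), of "\<lambda>b. real_of_int (b x)" "mean \<xi> x t"]
    divide_right_mono[OF variance_bound[OF assms(1-3)], of "r\<^sup>2"] by simp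

text \<open>With A = r / 2 the mean moves by at most r / 4 + t / r \<le> r / 2. A displacement above
  r then forces a deviation from the mean of at least r / 2, and Chebyshev at that level produces
  the factor 4.\<close>

lemma displacement_deviation:
  assumes "\<xi> \<in> Omega M N" "x \<le> L" "0 \<le> t" "0 < r" "t \<le> r\<^sup>2 / 4"
  shows "(\<Sum>b | b \<in> Omega M N \<and> r < \<bar>real_of_int (b x) - real_of_int (\<xi> x)\<bar>.
            trans_prob (Omega M N) (cf_rate (M + N)) t \<xi> b) \<le> 4 * real L / r\<^sup>2"
proof -
  have "\<bar>mean \<xi> x t - real_of_int (\<xi> x)\<bar> \<le> (r/2) / 2 + t / (2 * (r/2))"
    using assms by (intro mean_displacement) auto
  also have "t / (2 * (r/2)) \<le> r / 4"
    using assms by (simp add: field_simps power2_eq_square)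
  finally have m: "\<bar>mean \<xi> x t - real_of_int (\<xi> x)\<bar> \<le> r / 2" by simp
  have "(\<Sum>b | b \<in> Omega M N \<and> r < \<bar>real_of_int (b x) - real_of_int (\<xi> x)\<bar>.
            trans_prob (Omega M N) (cf_rate (M + N)) t \<xi> b)
     \<le> (\<Sum>b | b \<in> Omega M N \<and> r/2 \<le> \<bar>real_of_int (b x) - mean \<xi> x t\<bar>.
            trans_prob (Omega M N) (cf_rate (M + N)) t \<xi> b)"
  proof (rule sum_mono2)
    show "{b \<in> Omega M N. r < \<bar>real_of_int (b x) - real_of_int (\<xi> x)\<bar>}
        \<subseteq> {b \<in> Omega M N. r/2 \<le> \<bar>real_of_int (b x) - mean \<xi> x t\<bar>}"
    proof clarify
      fix b :: "nat \<Rightarrow> int" assume "r < \<bar>real_of_int (b x) - real_of_int (\<xi> x)\<bar>"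
      with m show "r/2 \<le> \<bar>real_of_int (b x) - mean \<xi> x t\<bar>" by linarith
    qed
  qed (use finite_Omega assms in \<open>auto intro!: trans_prob_nonneg\<close>)
  also have "\<dots> \<le> real L / (r/2)\<^sup>2"
    using assms by (intro mean_deviation) auto
  finally show ?thesis by (simp add: power_divide mult.commute)
qed

end

section \<open>Oscillation of a finite-state Markov chain\<close>

lemma grid_mono:
  fixes ts :: "nat \<Rightarrow> real"
  assumes step: "\<And>i. i < n \<Longrightarrow> ts i \<le> ts (Suc i)" and "j \<le> k" "k \<le> n"
  shows "ts j \<le> ts k"
  using assms(2,3)
proof (induction rule: dec_induct)
  case (step i)
  then have "ts j \<le> ts i" "ts i \<le> ts (Suc i)" using assms(1) by simp_all
  then show ?case by (rule order_trans)
qed simp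

locale finite_markov = q_matrix S Q + prob_space P
  for S :: "'s set" and Q :: "'s \<Rightarrow> 's \<Rightarrow> real" and P :: "'w measure" +
  fixes X :: "real \<Rightarrow> 'w \<Rightarrow> 's" and x0 :: 's
  assumes chain: "markov_chain_gen P X S Q x0"
begin

lemma X_in: "\<omega> \<in> space P \<Longrightarrow> 0 \<le> t \<Longrightarrow> X t \<omega> \<in> S"
  using chain by (auto simp: markov_chain_gen_def)

lemma X_measurable: "0 \<le> t \<Longrightarrow> X t \<in> measurable P (count_space UNIV)"
  using chain by (auto simp: markov_chain_gen_def)

lemma X_event:
  assumes "0 \<le> t"
  shows "{\<omega> \<in> space P. A (X t \<omega>)} \<in> events"
  using measurable_sets[OF X_measurable[OF assms], of "{x. A x}"] by (simp add: vimage_def Int_def conj_commute)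

lemma X_right_const:
  assumes "\<omega> \<in> space P" "0 \<le> t"
  obtains d where "d > 0" "\<And>s. t \<le> s \<Longrightarrow> s < t + d \<Longrightarrow> X s \<omega> = X t \<omega>"
proof -
  have "\<exists>d>0. \<forall>s\<in>{t..<t+d}. X s \<omega> = X t \<omega>"
    using chain assms by (auto simp: markov_chain_gen_def)
  then show ?thesis using that by (meson atLeastLessThan_iff)
qed

lemma path_prob:
  assumes "0 \<le> ts 0" "\<And>i. i < n \<Longrightarrow> ts i \<le> ts (Suc i)" "\<And>i. i \<le> n \<Longrightarrow> xs i \<in> S"
  shows "prob {\<omega>\<in>space P. \<forall>i\<le>n. X (ts i) \<omega> = xs i}
          = trans_prob S Q (ts 0) x0 (xs 0)
            * (\<Prod>i<n. trans_prob S Q (ts (Suc i) - ts i) (xs i) (xs (Suc i)))"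
  using chain assms by (auto simp: markov_chain_gen_def)

lemma marginal_le:
  assumes "0 \<le> t"
  shows "prob {\<omega> \<in> space P. A (X t \<omega>)} \<le> (\<Sum>b | b \<in> S \<and> A b. trans_prob S Q t x0 b)"
proof -
  have fin: "finite {b \<in> S. A b}" using finite_states by simp
  have "{\<omega> \<in> space P. A (X t \<omega>)} = (\<Union>b\<in>{b \<in> S. A b}. {\<omega> \<in> space P. X t \<omega> = b})"
    using X_in[OF _ assms] by auto
  also have "prob \<dots> \<le> (\<Sum>b | b \<in> S \<and> A b. prob {\<omega> \<in> space P. X t \<omega> = b})"
    using X_event[OF assms, of "\<lambda>x. x = _"] by (intro finite_measure_subadditive_finite fin) auto
  also have "\<dots> = (\<Sum>b | b \<in> S \<and> A b. trans_prob S Q t x0 b)"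
    using path_prob[of "\<lambda>_. t" 0 "\<lambda>_. _"] assms by (intro sum.cong) auto
  finally show ?thesis .
qed

section \<open>Events along finite time grids and the Markov property\<close>

lemma path_event:
  fixes n :: nat
  assumes "\<And>i. i \<le> n \<Longrightarrow> 0 \<le> ts i"
  shows "{\<omega>\<in>space P. \<forall>i\<le>n. X (ts i) \<omega> = xs i} \<in> events"
proof -
  have "{\<omega>\<in>space P. \<forall>i\<in>{..n}. X (ts i) \<omega> = xs i} \<in> events"
  proof (rule sets.sets_Collect_finite_All)
    show "{\<omega> \<in> space P. X (ts i) \<omega> = xs i} \<in> events" if "i \<in> {..n}" for i
      using X_event[OF assms, of i "\<lambda>x. x = xs i"] that by simp
  qed simp
  then show ?thesis by (simp only: Ball_def atMost_iff)
qed

text \<open>Restricting the sampled path to its index set makes it an element of a finite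
  extensional function space, so an arbitrary condition \<open>G\<close> on the past becomes a
  finite union of cylinders.\<close>

lemma path_predicate_UN:
  fixes n :: nat
  assumes "\<And>i. i \<le> n \<Longrightarrow> 0 \<le> ts i"
  shows "{\<omega> \<in> space P. G (\<lambda>i\<in>{..n}. X (ts i) \<omega>)}
       = (\<Union>f \<in> {f \<in> {..n} \<rightarrow>\<^sub>E S. G f}. {\<omega>\<in>space P. \<forall>i\<le>n. X (ts i) \<omega> = f i})" (is "?L = ?R")
proof
  show "?L \<subseteq> ?R"
  proof
    fix \<omega> assume w: "\<omega> \<in> ?L"
    have "(\<lambda>i\<in>{..n}. X (ts i) \<omega>) \<in> {..n} \<rightarrow>\<^sub>E S" using X_in w assms by auto
    then show "\<omega> \<in> ?R" using w by (intro UN_I[of "\<lambda>i\<in>{..n}. X (ts i) \<omega>"]) auto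
  qed
  show "?R \<subseteq> ?L"
  proof
    fix \<omega> assume "\<omega> \<in> ?R"
    then obtain f where f: "f \<in> {..n} \<rightarrow>\<^sub>E S" "G f" "\<omega> \<in> space P" "\<forall>i\<le>n. X (ts i) \<omega> = f i" by auto
    then have "(\<lambda>i\<in>{..n}. X (ts i) \<omega>) = f" by (auto simp: fun_eq_iff PiE_def extensional_def)
    then show "\<omega> \<in> ?L" using f by simp
  qed
qed

lemma finite_paths: "finite {f \<in> {..n::nat} \<rightarrow>\<^sub>E S. G f}"
  by (rule finite_subset[OF _ finite_PiE[of "{..n}" "\<lambda>_. S"]]) (auto simp: finite_states)

lemma path_predicate_event:
  fixes n :: nat
  assumes "\<And>i. i \<le> n \<Longrightarrow> 0 \<le> ts i"
  shows "{\<omega> \<in> space P. G (\<lambda>i\<in>{..n}. X (ts i) \<omega>)} \<in> events"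
  unfolding path_predicate_UN[of n ts G, OF assms, simplified]
  by (rule sets.finite_UN[OF finite_paths]) (rule path_event[OF assms])

lemma path_predicate_prob:
  fixes n :: nat
  assumes "\<And>i. i \<le> n \<Longrightarrow> 0 \<le> ts i"
  shows "prob {\<omega> \<in> space P. G (\<lambda>i\<in>{..n}. X (ts i) \<omega>)}
       = (\<Sum>f \<in> {f \<in> {..n} \<rightarrow>\<^sub>E S. G f}. prob {\<omega>\<in>space P. \<forall>i\<le>n. X (ts i) \<omega> = f i})"
  unfolding path_predicate_UN[of n ts G, OF assms, simplified]
proof (rule finite_measure_finite_Union[OF finite_paths])
  show "disjoint_family_on (\<lambda>f. {\<omega> \<in> space P. \<forall>i\<le>n. X (ts i) \<omega> = f i}) {f \<in> {..n} \<rightarrow>\<^sub>E S. G f}"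
    unfolding disjoint_family_on_def
  proof (intro ballI impI)
    fix f g assume fg: "f \<in> {f \<in> {..n} \<rightarrow>\<^sub>E S. G f}" "g \<in> {f \<in> {..n} \<rightarrow>\<^sub>E S. G f}" "f \<noteq> g"
    have "\<exists>i\<in>{..n}. f i \<noteq> g i"
    proof (rule ccontr)
      assume "\<not> ?thesis"
      then have "f = g" using fg(1,2) by (intro PiE_ext[of f "{..n}" "\<lambda>_. S" g]) auto
      with fg(3) show False by simp
    qed
    then obtain i where "i \<in> {..n}" "f i \<noteq> g i" by blast
    then show "{\<omega> \<in> space P. \<forall>i\<le>n. X (ts i) \<omega> = f i} \<inter> {\<omega> \<in> space P. \<forall>i\<le>n. X (ts i) \<omega> = g i} = {}"
      by auto
  qed
qed (rule image_subsetI, rule path_event[OF assms])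

text \<open>Appending \<open>u\<close> and \<open>y\<close> to the grid adds one factor to the
  product formula; this is the Markov property for cylinders.\<close>

lemma markov_step:
  assumes ts: "0 \<le> ts 0" "\<And>i. i < n \<Longrightarrow> ts i \<le> ts (Suc i)" "ts n \<le> u"
    and S: "\<And>i. i \<le> n \<Longrightarrow> xs i \<in> S" "y \<in> S"
  shows "prob {\<omega>\<in>space P. (\<forall>i\<le>n. X (ts i) \<omega> = xs i) \<and> X u \<omega> = y}
       = prob {\<omega>\<in>space P. \<forall>i\<le>n. X (ts i) \<omega> = xs i} * trans_prob S Q (u - ts n) (xs n) y"
proof -
  let ?ts = "ts(Suc n := u)" and ?xs = "xs(Suc n := y)"
  have "prob {\<omega>\<in>space P. (\<forall>i\<le>n. X (ts i) \<omega> = xs i) \<and> X u \<omega> = y}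
      = prob {\<omega>\<in>space P. \<forall>i\<le>Suc n. X (?ts i) \<omega> = ?xs i}"
    by (rule arg_cong[of _ _ prob]) (auto simp: le_Suc_eq)
  also have "\<dots> = trans_prob S Q (?ts 0) x0 (?xs 0)
            * (\<Prod>i<Suc n. trans_prob S Q (?ts (Suc i) - ?ts i) (?xs i) (?xs (Suc i)))"
  proof (rule path_prob)
    show "0 \<le> ?ts 0" using ts(1) by simp
    show "?ts i \<le> ?ts (Suc i)" if "i < Suc n" for i
    proof (cases "i = n")
      case True
      then show ?thesis using ts(3) by simp
    next
      case False
      then show ?thesis using ts(2)[of i] that by simp
    qed
    show "?xs i \<in> S" if "i \<le> Suc n" for i
      using S(1)[of i] S(2) that by (cases "i = Suc n") simp_all
  qed
  also have "\<dots> = trans_prob S Q (ts 0) x0 (xs 0)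
            * (\<Prod>i<n. trans_prob S Q (ts (Suc i) - ts i) (xs i) (xs (Suc i)))
            * trans_prob S Q (u - ts n) (xs n) y"
  proof -
    have "(\<Prod>i<n. trans_prob S Q (?ts (Suc i) - ?ts i) (?xs i) (?xs (Suc i)))
        = (\<Prod>i<n. trans_prob S Q (ts (Suc i) - ts i) (xs i) (xs (Suc i)))"
      by (rule prod.cong) (simp_all only: fun_upd_def lessThan_iff, auto)
    then show ?thesis by (simp only: prod.lessThan_Suc fun_upd_def) (simp add: mult.assoc)
  qed
  also have "\<dots> = prob {\<omega>\<in>space P. \<forall>i\<le>n. X (ts i) \<omega> = xs i} * trans_prob S Q (u - ts n) (xs n) y"
    using path_prob[OF ts(1,2) S(1), of n] by simp
  finally show ?thesis .
qed

text \<open>Splitting over past paths and next states leaves, for each past, a transition sum that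
  \<open>q\<close> bounds uniformly in the present state. This is the Markov property as an
  inequality, with an arbitrary past \<open>G\<close>.\<close>

lemma markov_bound:
  assumes ts: "0 \<le> ts 0" "\<And>i. i < n \<Longrightarrow> ts i \<le> ts (Suc i)" "ts n \<le> u"
    and q: "\<And>a. a \<in> S \<Longrightarrow> (\<Sum>y | y \<in> S \<and> R a y. trans_prob S Q (u - ts n) a y) \<le> q"
  shows "prob {\<omega>\<in>space P. G (\<lambda>i\<in>{..n}. X (ts i) \<omega>) \<and> R (X (ts n) \<omega>) (X u \<omega>)}
       \<le> q * prob {\<omega>\<in>space P. G (\<lambda>i\<in>{..n}. X (ts i) \<omega>)}"
proof -
  have ts0: "0 \<le> ts i" if "i \<le> n" for i
    using grid_mono[of n ts 0 i] ts that by simp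
  have u: "0 \<le> u" using order_trans[OF ts0[OF order_refl] ts(3)] .
  define F where "F = {f \<in> {..n} \<rightarrow>\<^sub>E S. G f}"
  have finF: "finite F" unfolding F_def by (rule finite_paths)
  have fS: "f i \<in> S" if "f \<in> F" "i \<le> n" for f i using that by (auto simp: F_def)
  define E where "E f = {\<omega>\<in>space P. \<forall>i\<le>n. X (ts i) \<omega> = f i}" for f
  define E' where "E' = (\<lambda>(f, y). {\<omega>\<in>space P. (\<forall>i\<le>n. X (ts i) \<omega> = f i) \<and> X u \<omega> = y})"
  define I where "I = (SIGMA f:F. {y \<in> S. R (f n) y})"
  have finI: "finite I" unfolding I_def using finF finite_states by auto
  have evE': "E' p \<in> events" for p
  proof -
    have "E' p = E (fst p) \<inter> {\<omega>\<in>space P. X u \<omega> = snd p}" by (auto simp: E_def E'_def split: prod.splits)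
    also have "\<dots> \<in> events" unfolding E_def
      by (intro sets.Int path_event[OF ts0] X_event[OF u, of "\<lambda>x. x = snd p"])
    finally show ?thesis .
  qed
  have "{\<omega>\<in>space P. G (\<lambda>i\<in>{..n}. X (ts i) \<omega>) \<and> R (X (ts n) \<omega>) (X u \<omega>)} \<subseteq> (\<Union>p\<in>I. E' p)"
  proof
    fix \<omega> assume w: "\<omega> \<in> {\<omega>\<in>space P. G (\<lambda>i\<in>{..n}. X (ts i) \<omega>) \<and> R (X (ts n) \<omega>) (X u \<omega>)}"
    define f where "f = (\<lambda>i\<in>{..n}. X (ts i) \<omega>)"
    have "f \<in> {..n} \<rightarrow>\<^sub>E S" using X_in w ts0 by (auto simp: f_def)
    moreover have "X u \<omega> \<in> S" using X_in w u by auto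
    moreover have "f n = X (ts n) \<omega>" by (simp add: f_def)
    ultimately have "(f, X u \<omega>) \<in> I" using w by (simp add: I_def F_def f_def[symmetric])
    moreover have "\<omega> \<in> E' (f, X u \<omega>)" using w by (auto simp: E'_def f_def)
    ultimately show "\<omega> \<in> (\<Union>p\<in>I. E' p)" by blast
  qed
  then have "prob {\<omega>\<in>space P. G (\<lambda>i\<in>{..n}. X (ts i) \<omega>) \<and> R (X (ts n) \<omega>) (X u \<omega>)} \<le> prob (\<Union>p\<in>I. E' p)"
    using finI evE' by (intro finite_measure_mono) auto
  also have "\<dots> \<le> (\<Sum>p\<in>I. prob (E' p))"
    using finI evE' by (intro finite_measure_subadditive_finite) auto
  also have "\<dots> = (\<Sum>f\<in>F. \<Sum>y | y \<in> S \<and> R (f n) y. prob (E' (f, y)))"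
    unfolding I_def using finF finite_states by (subst sum.Sigma) auto
  also have "\<dots> = (\<Sum>f\<in>F. prob (E f) * (\<Sum>y | y \<in> S \<and> R (f n) y. trans_prob S Q (u - ts n) (f n) y))"
  proof (intro sum.cong refl)
    fix f assume f: "f \<in> F"
    have "prob (E' (f, y)) = prob (E f) * trans_prob S Q (u - ts n) (f n) y" if "y \<in> S" for y
      unfolding E'_def E_def prod.case using markov_step[OF ts fS[OF f] that] .
    then show "(\<Sum>y | y \<in> S \<and> R (f n) y. prob (E' (f, y)))
        = prob (E f) * (\<Sum>y | y \<in> S \<and> R (f n) y. trans_prob S Q (u - ts n) (f n) y)"
      by (simp add: sum_distrib_left)
  qed
  also have "\<dots> \<le> (\<Sum>f\<in>F. prob (E f) * q)"
    using fS by (intro sum_mono mult_left_mono q) auto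
  also have "\<dots> = q * prob {\<omega>\<in>space P. G (\<lambda>i\<in>{..n}. X (ts i) \<omega>)}"
  proof -
    have "prob {\<omega>\<in>space P. G (\<lambda>i\<in>{..n}. X (ts i) \<omega>)} = (\<Sum>f\<in>F. prob (E f))"
      unfolding F_def E_def using ts0 by (intro path_predicate_prob)
    then show ?thesis by (simp add: sum_distrib_left mult.commute)
  qed
  finally show ?thesis .
qed

section \<open>Maximal inequality and oscillation of paths\<close>

text \<open>At the first grid time k of displacement above 2 r, either the final displacement will
  still exceed r, or the chain moves by more than r from time k to the end. The first event costs q.
  For the second, the first-exceedance events are disjoint, so the Markov bound summed over k costs
  q once more.\<close>

lemma ottaviani_grid:
  fixes g :: "'s \<Rightarrow> real"
  assumes ts: "0 \<le> ts 0" "\<And>i. i < n \<Longrightarrow> ts i \<le> ts (Suc i)"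
    and q: "\<And>a k. a \<in> S \<Longrightarrow> k \<le> n \<Longrightarrow>
        (\<Sum>y | y \<in> S \<and> r < \<bar>g y - g a\<bar>. trans_prob S Q (ts n - ts k) a y) \<le> q"
    and "0 \<le> q"
  shows "prob {\<omega>\<in>space P. \<exists>k\<le>n. 2 * r < \<bar>g (X (ts k) \<omega>) - g (X (ts 0) \<omega>)\<bar>} \<le> 2 * q"
proof -
  have tsle: "ts k \<le> ts n" if "k \<le> n" for k
    using grid_mono[of n ts k n] ts that by simp
  have ts0: "0 \<le> ts i" if "i \<le> n" for i
    using grid_mono[of n ts 0 i] ts that by simp
  \<comment> \<open>\<open>G k\<close> says that k is the first exceedance. It reads the path only
    up to index k, so it is a condition on the past.\<close>
  define G where "G k f \<longleftrightarrow> 2 * r < \<bar>g (f k) - g (f 0)\<bar> \<and> (\<forall>j<k. \<not> 2 * r < \<bar>g (f j) - g (f 0)\<bar>)"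
    for k :: nat and f :: "nat \<Rightarrow> 's"
  define A where "A k = {\<omega>\<in>space P. G k (\<lambda>i\<in>{..k}. X (ts i) \<omega>)}" for k
  define B where "B k = {\<omega>\<in>space P. G k (\<lambda>i\<in>{..k}. X (ts i) \<omega>) \<and> r < \<bar>g (X (ts n) \<omega>) - g (X (ts k) \<omega>)\<bar>}" for k
  define C where "C = {\<omega>\<in>space P. r < \<bar>g (X (ts n) \<omega>) - g (X (ts 0) \<omega>)\<bar>}"
  have G_iff: "G k (\<lambda>i\<in>{..k}. X (ts i) \<omega>) \<longleftrightarrow> G k (\<lambda>i. X (ts i) \<omega>)" for k \<omega>
    by (auto simp: G_def)
  have evA: "A k \<in> events" if "k \<le> n" for k
    unfolding A_def using that by (intro path_predicate_event ts0) auto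
  have evC: "C \<in> events"
    using path_predicate_event[of n ts "\<lambda>f. r < \<bar>g (f n) - g (f 0)\<bar>", OF ts0] by (simp add: C_def)
  have evB: "B k \<in> events" if "k \<le> n" for k
  proof -
    have "B k = A k \<inter> {\<omega>\<in>space P. r < \<bar>g (X (ts n) \<omega>) - g (X (ts k) \<omega>)\<bar>}"
      by (auto simp: A_def B_def)
    moreover have "{\<omega>\<in>space P. r < \<bar>g (X (ts n) \<omega>) - g (X (ts k) \<omega>)\<bar>} \<in> events"
      using path_predicate_event[of n ts "\<lambda>f. r < \<bar>g (f n) - g (f k)\<bar>", OF ts0] that by simp
    ultimately show ?thesis using evA[OF that] by auto
  qed
  have probC: "prob C \<le> q"
  proof -
    have "prob C \<le> q * prob {\<omega>\<in>space P. True}"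
      using markov_bound[of ts 0 "ts n" "\<lambda>a y. r < \<bar>g y - g a\<bar>" q "\<lambda>_. True"] ts tsle[of 0] q[of _ 0]
      by (simp add: C_def)
    then show ?thesis by (simp add: prob_space)
  qed
  have probB: "prob (B k) \<le> q * prob (A k)" if "k \<le> n" for k
    unfolding B_def A_def
    by (rule markov_bound[where R = "\<lambda>a y. r < \<bar>g y - g a\<bar>"]) (use ts tsle q that in auto)
  have disj: "disjoint_family_on A {..n}"
    unfolding disjoint_family_on_def
  proof (intro ballI impI)
    fix j k :: nat assume "j \<noteq> k"
    then show "A j \<inter> A k = {}"
      unfolding A_def G_iff by (cases j k rule: linorder_cases) (auto simp: G_def)
  qed
  have "{\<omega>\<in>space P. \<exists>k\<le>n. 2 * r < \<bar>g (X (ts k) \<omega>) - g (X (ts 0) \<omega>)\<bar>} \<subseteq> C \<union> (\<Union>k\<in>{..n}. B k)"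
  proof
    fix \<omega> assume "\<omega> \<in> {\<omega>\<in>space P. \<exists>k\<le>n. 2 * r < \<bar>g (X (ts k) \<omega>) - g (X (ts 0) \<omega>)\<bar>}"
    then have w: "\<omega> \<in> space P" and ex: "\<exists>k. k \<le> n \<and> 2 * r < \<bar>g (X (ts k) \<omega>) - g (X (ts 0) \<omega>)\<bar>" by auto
    define k where "k = (LEAST k. k \<le> n \<and> 2 * r < \<bar>g (X (ts k) \<omega>) - g (X (ts 0) \<omega>)\<bar>)"
    from LeastI_ex[OF ex] have k: "k \<le> n" "2 * r < \<bar>g (X (ts k) \<omega>) - g (X (ts 0) \<omega>)\<bar>"
      by (auto simp: k_def)
    have "G k (\<lambda>i. X (ts i) \<omega>)"
      using k not_less_Least[of _ "\<lambda>k. k \<le> n \<and> 2 * r < \<bar>g (X (ts k) \<omega>) - g (X (ts 0) \<omega>)\<bar>"]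
      by (force simp: G_def k_def[symmetric])
    then have "\<omega> \<in> C \<or> \<omega> \<in> B k" using k w unfolding C_def B_def G_iff by auto
    then show "\<omega> \<in> C \<union> (\<Union>k\<in>{..n}. B k)" using k by auto
  qed
  then have "prob {\<omega>\<in>space P. \<exists>k\<le>n. 2 * r < \<bar>g (X (ts k) \<omega>) - g (X (ts 0) \<omega>)\<bar>}
      \<le> prob (C \<union> (\<Union>k\<in>{..n}. B k))"
    using evC evB by (intro finite_measure_mono) auto
  also have "\<dots> \<le> prob C + prob (\<Union>k\<in>{..n}. B k)"
    using evC evB by (intro measure_Un_le) auto
  also have "prob (\<Union>k\<in>{..n}. B k) \<le> (\<Sum>k\<in>{..n}. prob (B k))"
    using evB by (intro finite_measure_subadditive_finite) auto
  also have "\<dots> \<le> (\<Sum>k\<in>{..n}. q * prob (A k))"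
    by (intro sum_mono probB) auto
  also have "\<dots> = q * prob (\<Union>k\<in>{..n}. A k)"
    using evA disj by (subst finite_measure_finite_Union) (auto simp: sum_distrib_left)
  also have "\<dots> \<le> q * 1" using \<open>0 \<le> q\<close> by (intro mult_left_mono) auto
  finally show ?thesis using probC by simp
qed

text \<open>On dyadic grids the exceptional events increase while the bound 2 q stays the same, so
  it passes to their union. Off that union, a path that is constant just to the right of t shares
  its value at t with a grid point.\<close>

lemma oscillation_bound:
  fixes g :: "'s \<Rightarrow> real"
  assumes s: "0 \<le> s" and D: "0 < D"
    and q: "\<And>a u. a \<in> S \<Longrightarrow> 0 \<le> u \<Longrightarrow> u \<le> D \<Longrightarrow>
        (\<Sum>y | y \<in> S \<and> r < \<bar>g y - g a\<bar>. trans_prob S Q u a y) \<le> q"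
    and "0 \<le> q"
  obtains W where "W \<in> events" "prob W \<le> 2 * q"
    "\<And>\<omega> t. \<omega> \<in> space P - W \<Longrightarrow> s \<le> t \<Longrightarrow> t \<le> s + D \<Longrightarrow> \<bar>g (X t \<omega>) - g (X s \<omega>)\<bar> \<le> 2 * r"
proof -
  define ts where "ts n i = s + D * real i / 2 ^ n" for n i :: nat
  define B where "B n = {\<omega>\<in>space P. \<exists>k\<le>2^n. 2 * r < \<bar>g (X (ts n k) \<omega>) - g (X (ts n 0) \<omega>)\<bar>}" for n
  have ts0: "0 \<le> ts n i" for n i using s D by (simp add: ts_def)
  have ts_0: "ts n 0 = s" for n by (simp add: ts_def)
  have evB: "B n \<in> events" for n
  proof -
    have "B n = {\<omega> \<in> space P. (\<lambda>f. \<exists>k\<le>2^n. 2 * r < \<bar>g (f k) - g (f 0)\<bar>)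
        (\<lambda>i\<in>{..2^n}. X (ts n i) \<omega>)}"
      by (auto simp: B_def)
    then show ?thesis
      using path_predicate_event[of "2^n" "ts n" "\<lambda>f. \<exists>k\<le>2^n. 2 * r < \<bar>g (f k) - g (f 0)\<bar>", OF ts0]
      by (simp only:)
  qed
  have probB: "prob (B n) \<le> 2 * q" for n
    unfolding B_def
  proof (rule ottaviani_grid[OF ts0])
    show "ts n i \<le> ts n (Suc i)" for i using D by (simp add: ts_def field_simps)
    fix a and k :: nat assume a: "a \<in> S" and k: "k \<le> 2 ^ n"
    have kr: "real k \<le> 2 ^ n" using k by (simp add: numeral_power_le_of_nat_cancel_iff of_nat_le_numeral_power_cancel_iff)
    have e: "ts n (2 ^ n) - ts n k = D * (1 - real k / 2 ^ n)"
      by (simp add: ts_def field_simps)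
    have "0 \<le> real k / 2 ^ n" "real k / 2 ^ n \<le> 1" using kr by (auto simp: field_simps)
    then have "0 \<le> D * (1 - real k / 2 ^ n)" "D * (1 - real k / 2 ^ n) \<le> D"
      using D mult_left_mono[of "1 - real k / 2 ^ n" 1 D] by auto
    then show "(\<Sum>y | y \<in> S \<and> r < \<bar>g y - g a\<bar>. trans_prob S Q (ts n (2 ^ n) - ts n k) a y) \<le> q"
      unfolding e by (intro q a)
  qed fact
  have "incseq B"
  proof (rule incseq_SucI, rule subsetI)
    fix n \<omega> assume "\<omega> \<in> B n"
    then obtain k where k: "k \<le> 2 ^ n" "\<omega> \<in> space P" "2 * r < \<bar>g (X (ts n k) \<omega>) - g (X s \<omega>)\<bar>"
      by (auto simp: B_def ts_0)
    moreover have "ts (Suc n) (2 * k) = ts n k" by (simp add: ts_def)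
    ultimately show "\<omega> \<in> B (Suc n)" by (auto simp: B_def ts_0 intro!: exI[of _ "2 * k"])
  qed
  then have "(\<lambda>n. prob (B n)) \<longlonglongrightarrow> prob (\<Union>n. B n)"
    using evB by (intro finite_Lim_measure_incseq) auto
  then have "prob (\<Union>n. B n) \<le> 2 * q"
    using probB by (intro LIMSEQ_le_const2) auto
  moreover have "\<bar>g (X t \<omega>) - g (X s \<omega>)\<bar> \<le> 2 * r"
    if w: "\<omega> \<in> space P - (\<Union>n. B n)" and t: "s \<le> t" "t \<le> s + D" for \<omega> t
  proof (rule ccontr)
    assume neg: "\<not> \<bar>g (X t \<omega>) - g (X s \<omega>)\<bar> \<le> 2 * r"
    obtain d where d: "d > 0" "\<And>u. t \<le> u \<Longrightarrow> u < t + d \<Longrightarrow> X u \<omega> = X t \<omega>"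
      using X_right_const[of \<omega> t] w t s by (metis DiffD1 order_trans)
    obtain n where n: "(1/2) ^ n < d / D"
      using real_arch_pow_inv[of "d / D" "1/2"] d D by auto
    \<comment> \<open>Rounding up puts the grid point at or after t, where right constancy applies,
      and by less than D / 2^n < d; it stays in the window since t \<le> s + D.\<close>
    define k where "k = nat \<lceil>(t - s) / D * 2 ^ n\<rceil>"
    have nn: "0 \<le> (t - s) / D * 2 ^ n" using t D by simp
    have k1: "(t - s) / D * 2 ^ n \<le> real k" "real k < (t - s) / D * 2 ^ n + 1"
      unfolding k_def using nn by linarith+
    have "(t - s) / D \<le> 1" using t D by simp
    then have "(t - s) / D * 2 ^ n \<le> 1 * 2 ^ n" by (intro mult_right_mono) auto
    then have "\<lceil>(t - s) / D * 2 ^ n\<rceil> \<le> 2 ^ n" by (simp add: ceiling_le_iff)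
    then have k2: "k \<le> 2 ^ n" unfolding k_def by (simp add: nat_le_iff)
    have "t \<le> ts n k" unfolding ts_def using k1(1) D by (simp add: field_simps)
    moreover have "ts n k < t + d"
    proof -
      have "D * real k / 2 ^ n < D * ((t - s) / D * 2 ^ n + 1) / 2 ^ n"
        using k1(2) D by (intro divide_strict_right_mono mult_strict_left_mono) auto
      also have "\<dots> = (t - s) + D * (1/2) ^ n" using D by (simp add: field_simps power_divide)
      also have "\<dots> < (t - s) + d" using n D by (simp add: field_simps)
      finally show ?thesis by (simp add: ts_def)
    qed
    ultimately have "X (ts n k) \<omega> = X t \<omega>" by (rule d(2))
    then have "\<omega> \<in> B n" using neg w k2 by (auto simp: B_def ts_0 intro!: exI[of _ k])
    then show False using w by auto
  qed
  ultimately show ?thesis using evB by (intro that[of "\<Union>n. B n"]) auto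
qed

end

section \<open>Convergence of the discrete heat equation\<close>

text \<open>Continuity and equation as in \<open>heat_solution\<close>, split from the boundary and
  initial data so that solutions can be superposed.\<close>

definition heat_eq :: "(real \<Rightarrow> real \<Rightarrow> real) \<Rightarrow> bool" where
  "heat_eq w \<longleftrightarrow> continuous_on ({0..1} \<times> {0..}) (\<lambda>(x, t). w x t)
   \<and> (\<forall>x\<in>{0<..<1}. \<forall>t>0. \<exists>g dt.
        (\<forall>y\<in>{0<..<1}. ((\<lambda>z. w z t) has_real_derivative g y) (at y))
      \<and> ((\<lambda>s. w x s) has_real_derivative dt) (at t)
      \<and> (g has_real_derivative 2 * dt) (at x))"

lemma heat_eqD:
  assumes "heat_eq w" "x \<in> {0<..<1}" "0 < t"
  obtains g dt where "\<And>y. y \<in> {0<..<1} \<Longrightarrow> ((\<lambda>z. w z t) has_real_derivative g y) (at y)"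
    "(w x has_real_derivative dt) (at t)" "(g has_real_derivative 2 * dt) (at x)"
  using assms unfolding heat_eq_def by blast

lemma heat_eq_continuous: "heat_eq w \<Longrightarrow> continuous_on ({0..1} \<times> {0..}) (\<lambda>(x, t). w x t)"
  by (simp add: heat_eq_def)

lemma heat_eqI:
  assumes "continuous_on ({0..1} \<times> {0..}) (\<lambda>p. w (fst p) (snd p))"
    and "\<And>x t. x \<in> {0<..<1} \<Longrightarrow> 0 < t \<Longrightarrow> \<exists>g dt.
        (\<forall>y\<in>{0<..<1}. ((\<lambda>z. w z t) has_real_derivative g y) (at y))
      \<and> (w x has_real_derivative dt) (at t) \<and> (g has_real_derivative 2 * dt) (at x)"
  shows "heat_eq w"
  using assms unfolding heat_eq_def by (simp add: case_prod_beta')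

lemma heat_eq_add:
  assumes "heat_eq v" "heat_eq w"
  shows "heat_eq (\<lambda>x t. v x t + w x t)"
proof (rule heat_eqI)
  show "continuous_on ({0..1} \<times> {0..}) (\<lambda>p. v (fst p) (snd p) + w (fst p) (snd p))"
    using heat_eq_continuous[OF assms(1)] heat_eq_continuous[OF assms(2)]
    by (intro continuous_on_add) (simp_all add: case_prod_beta')
  fix x t :: real assume xt: "x \<in> {0<..<1}" "0 < t"
  obtain g dt where 1: "\<And>y. y \<in> {0<..<1} \<Longrightarrow> ((\<lambda>z. v z t) has_real_derivative g y) (at y)"
    "(v x has_real_derivative dt) (at t)" "(g has_real_derivative 2 * dt) (at x)"
    using heat_eqD[OF assms(1) xt] by blast
  obtain g' dt' where 2: "\<And>y. y \<in> {0<..<1} \<Longrightarrow> ((\<lambda>z. w z t) has_real_derivative g' y) (at y)"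
    "(w x has_real_derivative dt') (at t)" "(g' has_real_derivative 2 * dt') (at x)"
    using heat_eqD[OF assms(2) xt] by blast
  have "((\<lambda>y. g y + g' y) has_real_derivative 2 * (dt + dt')) (at x)"
    using DERIV_add[OF 1(3) 2(3)] by (simp add: distrib_left)
  then show "\<exists>g dt. (\<forall>y\<in>{0<..<1}. ((\<lambda>z. v z t + w z t) has_real_derivative g y) (at y))
      \<and> ((\<lambda>t. v x t + w x t) has_real_derivative dt) (at t) \<and> (g has_real_derivative 2 * dt) (at x)"
    using DERIV_add[OF 1(1) 2(1)] DERIV_add[OF 1(2) 2(2)]
    by (intro exI[of _ "\<lambda>y. g y + g' y"] exI[of _ "dt + dt'"]) auto
qed

lemma heat_eq_cmult:
  assumes "heat_eq v"
  shows "heat_eq (\<lambda>x t. c * v x t)"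
proof (rule heat_eqI)
  show "continuous_on ({0..1} \<times> {0..}) (\<lambda>p. c * v (fst p) (snd p))"
    using heat_eq_continuous[OF assms(1)]
    by (intro continuous_on_mult_left) (simp_all add: case_prod_beta')
  fix x t :: real assume xt: "x \<in> {0<..<1}" "0 < t"
  obtain g dt where 1: "\<And>y. y \<in> {0<..<1} \<Longrightarrow> ((\<lambda>z. v z t) has_real_derivative g y) (at y)"
    "(v x has_real_derivative dt) (at t)" "(g has_real_derivative 2 * dt) (at x)"
    using heat_eqD[OF assms(1) xt] by blast
  have "((\<lambda>y. c * g y) has_real_derivative 2 * (c * dt)) (at x)"
    using DERIV_cmult[OF 1(3), of c] by (simp add: mult.left_commute)
  then show "\<exists>g dt. (\<forall>y\<in>{0<..<1}. ((\<lambda>z. c * v z t) has_real_derivative g y) (at y))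
      \<and> ((\<lambda>t. c * v x t) has_real_derivative dt) (at t) \<and> (g has_real_derivative 2 * dt) (at x)"
    using DERIV_cmult[OF 1(1), of _ c] DERIV_cmult[OF 1(2), of c]
    by (intro exI[of _ "\<lambda>y. c * g y"] exI[of _ "c * dt"]) auto
qed

lemma heat_eq_affine: "heat_eq (\<lambda>x t. a + b * x)"
proof (rule heat_eqI)
  show "continuous_on ({0..1} \<times> {0..}) (\<lambda>p::real \<times> real. a + b * fst p)"
    by (intro continuous_intros)
  show "\<exists>g dt. (\<forall>y\<in>{0<..<1}. ((\<lambda>z. a + b * z) has_real_derivative g y) (at y))
      \<and> ((\<lambda>t. a + b * x) has_real_derivative dt) (at t) \<and> (g has_real_derivative 2 * dt) (at x)" for x t :: real
    by (rule exI[of _ "\<lambda>_. b"], rule exI[of _ 0]) (auto intro!: derivative_eq_intros)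
qed

lemma heat_eq_sine: "heat_eq (\<lambda>x t. exp (- (b\<^sup>2 / 2) * t) * sin (b * x))"
proof (rule heat_eqI)
  show "continuous_on ({0..1} \<times> {0..}) (\<lambda>p::real \<times> real. exp (- (b\<^sup>2 / 2) * snd p) * sin (b * fst p))"
    by (intro continuous_intros)
  fix x t :: real
  have "((\<lambda>z. exp (- (b\<^sup>2 / 2) * t) * sin (b * z)) has_real_derivative
      exp (- (b\<^sup>2 / 2) * t) * (b * cos (b * y))) (at y)" for y
    by (auto intro!: derivative_eq_intros)
  moreover have "((\<lambda>t. exp (- (b\<^sup>2 / 2) * t) * sin (b * x)) has_real_derivative
      - (b\<^sup>2 / 2) * exp (- (b\<^sup>2 / 2) * t) * sin (b * x)) (at t)"
    by (auto intro!: derivative_eq_intros)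
  moreover have "((\<lambda>y. exp (- (b\<^sup>2 / 2) * t) * (b * cos (b * y))) has_real_derivative
      2 * (- (b\<^sup>2 / 2) * exp (- (b\<^sup>2 / 2) * t) * sin (b * x))) (at x)"
    by (auto intro!: derivative_eq_intros simp: power2_eq_square)
  ultimately show "\<exists>g dt. (\<forall>y\<in>{0<..<1}. ((\<lambda>z. exp (- (b\<^sup>2 / 2) * t) * sin (b * z)) has_real_derivative g y) (at y))
      \<and> ((\<lambda>t. exp (- (b\<^sup>2 / 2) * t) * sin (b * x)) has_real_derivative dt) (at t)
      \<and> (g has_real_derivative 2 * dt) (at x)"
    by (intro exI[of _ "\<lambda>y. exp (- (b\<^sup>2 / 2) * t) * (b * cos (b * y))"]
        exI[of _ "- (b\<^sup>2 / 2) * exp (- (b\<^sup>2 / 2) * t) * sin (b * x)"]) blast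
qed

text \<open>The minimum of w + k t over a compact rectangle, if negative, lies off the initial and
  lateral sides. There w has time derivative at most -k, so its second space derivative is negative,
  which is incompatible with a spatial minimum.\<close>

lemma heat_eq_min_principle:
  assumes w: "heat_eq w" and init: "\<And>x. x \<in> {0..1} \<Longrightarrow> 0 \<le> w x 0"
    and bdry: "\<And>t. 0 < t \<Longrightarrow> 0 \<le> w 0 t" "\<And>t. 0 < t \<Longrightarrow> 0 \<le> w 1 t"
    and x: "x \<in> {0..1}" and t: "0 \<le> t"
  shows "0 \<le> w x t"
proof (rule ccontr)
  assume neg: "\<not> 0 \<le> w x t"
  have "t \<noteq> 0" using neg init[OF x] by auto
  then have "0 < t" using t by simp
  define k where "k = - w x t / (2 * t)"
  have k: "0 < k" "w x t + k * t < 0"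
    using neg \<open>0 < t\<close> by (auto simp: k_def field_simps)
  define v where "v y s = w y s + k * s" for y s
  have "continuous_on ({0..1} \<times> {0..t}) (\<lambda>p. (\<lambda>(x, t). w x t) p + k * snd p)"
    by (intro continuous_intros continuous_on_subset[OF heat_eq_continuous[OF w]]) auto
  then have cont: "continuous_on ({0..1} \<times> {0..t}) (\<lambda>(y, s). v y s)"
    by (simp add: v_def case_prod_beta')
  have "compact ({0..1::real} \<times> {0..t})" by (intro compact_Times compact_Icc)
  moreover have "{0..1::real} \<times> {0..t} \<noteq> {}" using t by auto
  ultimately obtain p where p: "p \<in> {0..1} \<times> {0..t}"
      "\<And>q. q \<in> {0..1} \<times> {0..t} \<Longrightarrow> (\<lambda>(y, s). v y s) p \<le> (\<lambda>(y, s). v y s) q"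
    using continuous_attains_inf[OF _ _ cont] by blast
  obtain y s where ps: "p = (y, s)" by fastforce
  have y: "y \<in> {0..1}" and s: "s \<in> {0..t}" using p(1) ps by auto
  have least: "v y s \<le> v y' s'" if "y' \<in> {0..1}" "s' \<in> {0..t}" for y' s'
    using p(2)[of "(y', s')"] that ps by simp
  have vneg: "v y s < 0" using least[OF x, of t] k t by (simp add: v_def)
  have "s \<noteq> 0" using vneg init[OF y] by (auto simp: v_def)
  then have s0: "0 < s" using s by simp
  have ks: "0 \<le> k * s" using k s0 by simp
  have "y \<noteq> 0" "y \<noteq> 1" using vneg bdry[OF s0] ks by (auto simp: v_def)
  then have y0: "y \<in> {0<..<1}" using y by auto
  obtain g dt where g: "\<And>z. z \<in> {0<..<1} \<Longrightarrow> ((\<lambda>z. w z s) has_real_derivative g z) (at z)"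
    "(w y has_real_derivative dt) (at s)" "(g has_real_derivative 2 * dt) (at y)"
    using heat_eqD[OF w y0 s0] by blast
  \<comment> \<open>The minimum may lie on the top edge of the rectangle, so only earlier times are
    compared.\<close>
  have "dt + k \<le> 0"
  proof (rule ccontr)
    assume "\<not> dt + k \<le> 0"
    moreover have "(v y has_real_derivative dt + k) (at s)"
      unfolding v_def[abs_def] by (auto intro!: derivative_eq_intros g(2))
    ultimately obtain d where d: "d > 0" "\<And>e. 0 < e \<Longrightarrow> e < d \<Longrightarrow> v y (s - e) < v y s"
      using DERIV_pos_inc_left[of "v y" "dt + k" s] by auto
    define e where "e = min (d/2) s"
    have "v y (s - e) < v y s" using d s0 by (auto simp: e_def)
    moreover have "v y s \<le> v y (s - e)"
      using s s0 d by (intro least y) (auto simp: e_def)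
    ultimately show False by simp
  qed
  then have dt: "2 * dt < 0" using k by linarith
  have gv: "((\<lambda>z. v z s) has_real_derivative g z) (at z)" if "z \<in> {0<..<1}" for z
    unfolding v_def using g(1)[OF that] by (auto intro!: derivative_eq_intros)
  have "g y = 0"
  proof (rule DERIV_local_min[OF gv[OF y0], of "min y (1 - y)"])
    show "0 < min y (1 - y)" using y0 by auto
    show "\<forall>z. \<bar>y - z\<bar> < min y (1 - y) \<longrightarrow> v y s \<le> v z s"
      using s by (auto intro!: least simp: abs_if split: if_splits)
  qed
  \<comment> \<open>Vanishing at y with negative slope, \<open>g\<close> is negative just to the
    right; the mean value theorem turns this into a value below the minimum.\<close>
  then obtain d where d: "d > 0" "\<And>h. 0 < h \<Longrightarrow> h < d \<Longrightarrow> g (y + h) < 0"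
    using DERIV_neg_dec_right[OF g(3) dt] by auto
  define h where "h = min (d/2) ((1 - y)/2)"
  have h: "0 < h" "h < d" "y + h < 1" using d y0 by (auto simp: h_def min_def field_simps)
  have "\<exists>z. y < z \<and> z < y + h \<and> v (y + h) s - v y s = (y + h - y) * g z"
    using h y0 by (intro MVT2 gv) auto
  then obtain z where z: "y < z" "z < y + h" "v (y + h) s - v y s = h * g z" by auto
  have "g z < 0" using d(2)[of "z - y"] z h by simp
  then have "v (y + h) s < v y s" using z h mult_pos_neg[of h "g z"] by simp
  moreover have "v y s \<le> v (y + h) s" using h y0 s by (intro least) auto
  ultimately show False by simp
qed

lemma heat_eq_bound:
  assumes w: "heat_eq w" and init: "\<And>x. x \<in> {0..1} \<Longrightarrow> \<bar>w x 0\<bar> \<le> e"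
    and bdry: "\<And>t. 0 < t \<Longrightarrow> w 0 t = 0" "\<And>t. 0 < t \<Longrightarrow> w 1 t = 0"
    and x: "x \<in> {0..1}" and t: "0 \<le> t"
  shows "\<bar>w x t\<bar> \<le> e"
proof -
  have e: "0 \<le> e" using init[of 0] by simp
  \<comment> \<open>The term 0 * x shapes the constant as an instance of
    \<open>heat_eq_affine\<close>; the two signs c give the two bounds.\<close>
  have "0 \<le> (e + 0 * x) + c * w x t" if "c \<in> {-1, 1}" for c
  proof (rule heat_eq_min_principle[where w = "\<lambda>x t. (e + 0 * x) + c * w x t", OF _ _ _ _ x t])
    show "heat_eq (\<lambda>x t. (e + 0 * x) + c * w x t)"
      by (intro heat_eq_add heat_eq_affine heat_eq_cmult w)
    show "0 \<le> (e + 0 * x) + c * w x 0" if "x \<in> {0..1}" for x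
      using init[OF that] \<open>c \<in> {-1, 1}\<close> by auto
  qed (use e bdry in auto)
  from this[of 1] this[of "-1"] show ?thesis by auto
qed

section \<open>Approximation by sine polynomials\<close>

inductive sine_poly :: "(real \<Rightarrow> real) \<Rightarrow> bool" where
  zero: "sine_poly (\<lambda>x. 0)"
| add_mode: "sine_poly f \<Longrightarrow> sine_poly (\<lambda>x. f x + c * sin (real k * pi * x))"

lemma sine_poly_add:
  assumes "sine_poly f" "sine_poly g"
  shows "sine_poly (\<lambda>x. f x + g x)"
  using assms(2)
proof induction
  case zero
  then show ?case using assms(1) by simp
next
  case (add_mode g c k)
  then show ?case using sine_poly.add_mode[of "\<lambda>x. f x + g x" c k] by (simp add: add.assoc)
qed

lemma sine_poly_cmult:
  assumes "sine_poly f"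
  shows "sine_poly (\<lambda>x. a * f x)"
  using assms
proof induction
  case zero
  then show ?case using sine_poly.zero by simp
next
  case (add_mode g c k)
  then show ?case using sine_poly.add_mode[of "\<lambda>x. a * g x" "a * c" k] by (simp add: distrib_left mult.assoc)
qed

text \<open>By the product-to-sum formula, multiplication by cos (pi x) splits frequency k into k +
  1 and k - 1.\<close>

lemma sine_poly_cos:
  assumes "sine_poly f"
  shows "sine_poly (\<lambda>x. f x * cos (pi * x))"
  using assms
proof induction
  case zero
  then show ?case using sine_poly.zero by simp
next
  case (add_mode f c k)
  show ?case
  proof (cases k)
    case 0
    then show ?thesis using add_mode by simp
  next
    case (Suc j)
    have "sin (real k * pi * x) * cos (pi * x)
        = (sin (real (k + 1) * pi * x) + sin (real j * pi * x)) / 2" for x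
    proof -
      have "real (k + 1) * pi * x = real k * pi * x + pi * x"
        "real j * pi * x = real k * pi * x - pi * x"
        using Suc by (auto simp: algebra_simps)
      then show ?thesis by (simp add: sin_add sin_diff)
    qed
    then have "(f x + c * sin (real k * pi * x)) * cos (pi * x)
        = (f x * cos (pi * x) + c / 2 * sin (real (k + 1) * pi * x)) + c / 2 * sin (real j * pi * x)" for x
      by (simp add: distrib_right mult.assoc add_divide_distrib distrib_left)
    then show ?thesis
      using sine_poly.add_mode[OF sine_poly.add_mode[OF add_mode.IH, of "c/2" "k + 1"], of "c/2" j]
      by simp
  qed
qed

lemma sine_poly_polynomial:
  "sine_poly (\<lambda>x. sin (pi * x) * (\<Sum>i\<le>n. a i * cos (pi * x) ^ i))"
proof -
  have mono: "sine_poly (\<lambda>x. sin (pi * x) * cos (pi * x) ^ i)" for i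
  proof (induction i)
    case 0
    then show ?case using sine_poly.add_mode[OF sine_poly.zero, of 1 1] by simp
  next
    case (Suc i)
    then show ?case using sine_poly_cos[OF Suc.IH] by (simp add: mult_ac)
  qed
  show ?thesis
  proof (induction n)
    case 0
    then show ?case using sine_poly_cmult[OF mono[of 0], of "a 0"] by (simp add: mult.commute)
  next
    case (Suc n)
    then show ?case
      using sine_poly_add[OF Suc.IH sine_poly_cmult[OF mono[of "Suc n"], of "a (Suc n)"]]
      by (simp add: distrib_left mult_ac)
  qed
qed

text \<open>
  \<open>\<psi>\<close> is first replaced by \<open>\<psi> s\<^sup>2 / (s\<^sup>2 + d)\<close> with \<open>s = sin (\<pi> x)\<close>, which is \<open>s\<close> times a continuous
  function of \<open>cos (\<pi> x)\<close>; polynomials in the cosine times \<open>s\<close> are sine polynomials.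
\<close>

lemma sine_poly_approx:
  fixes \<psi> :: "real \<Rightarrow> real"
  assumes cont: "continuous_on {0..1} \<psi>" and ends: "\<psi> 0 = 0" "\<psi> 1 = 0" and e: "0 < e"
  obtains f where "sine_poly f" "\<And>x. x \<in> {0..1} \<Longrightarrow> \<bar>\<psi> x - f x\<bar> \<le> e"
proof -
  have sin_nonneg: "0 \<le> sin (pi * x)" if "x \<in> {0..1}" for x
    using that by (intro sin_ge_zero) (auto simp: mult_left_le)
  obtain B where B: "0 < B" "\<And>x. x \<in> {0..1} \<Longrightarrow> \<bar>\<psi> x\<bar> \<le> B"
    using compact_imp_bounded[OF compact_continuous_image[OF cont compact_Icc]]
    unfolding bounded_pos by auto
  \<comment> \<open>The set where |\<psi>| \<ge> e / 2 is compact and avoids 0 and 1, so the squared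
    sine has a positive minimum on it.\<close>
  obtain m where m: "0 < m" "\<And>x. x \<in> {0..1} \<Longrightarrow> e / 2 \<le> \<bar>\<psi> x\<bar> \<Longrightarrow> m \<le> (sin (pi * x))\<^sup>2"
  proof (cases "{x \<in> {0..1}. e / 2 \<le> \<bar>\<psi> x\<bar>} = {}")
    case True
    then show ?thesis using that[of 1] by auto
  next
    case False
    have "closed {x \<in> {0..1}. e / 2 \<le> \<bar>\<psi> x\<bar>}"
      using continuous_closed_preimage[OF continuous_on_rabs[OF cont], of "{e/2..}"]
      by (auto simp: vimage_def Int_def)
    moreover have "bounded {x \<in> {0..1}. e / 2 \<le> \<bar>\<psi> x\<bar>}"
      by (rule bounded_subset[OF bounded_closed_interval[of 0 1]]) auto
    ultimately have "compact {x \<in> {0..1}. e / 2 \<le> \<bar>\<psi> x\<bar>}" by (simp add: compact_eq_bounded_closed)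
    then have "\<exists>x\<in>{x \<in> {0..1}. e / 2 \<le> \<bar>\<psi> x\<bar>}. \<forall>y\<in>{x \<in> {0..1}. e / 2 \<le> \<bar>\<psi> x\<bar>}.
        (sin (pi * x))\<^sup>2 \<le> (sin (pi * y))\<^sup>2"
      by (intro continuous_attains_inf False continuous_intros)
    then obtain x where x: "x \<in> {0..1}" "e / 2 \<le> \<bar>\<psi> x\<bar>"
      "\<And>y. y \<in> {0..1} \<Longrightarrow> e / 2 \<le> \<bar>\<psi> y\<bar> \<Longrightarrow> (sin (pi * x))\<^sup>2 \<le> (sin (pi * y))\<^sup>2" by auto
    have "x \<noteq> 0" "x \<noteq> 1" using x(2) ends e by auto
    then have "0 < sin (pi * x)" using x(1) by (intro sin_gt_zero) auto
    then show ?thesis using x that[of "(sin (pi * x))\<^sup>2"] by auto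
  qed
  \<comment> \<open>Chosen so that B d / m = e / 2, the error allowed where |\<psi>| is
    large.\<close>
  define d where "d = m * e / (2 * B)"
  have d: "0 < d" using m e B by (simp add: d_def)
  \<comment> \<open>Since sqrt (1 - c^2) = sin (arccos c), this is the damped function divided by
    one sine factor and read in the variable c = cos (pi x).\<close>
  define q where "q c = \<psi> (arccos c / pi) * sqrt (1 - c\<^sup>2) / (1 - c\<^sup>2 + d)" for c
  have pos: "0 < 1 - c\<^sup>2 + d" if "c \<in> {-1..1}" for c
    using that d abs_square_le_1[of c] by (simp add: abs_le_iff)
  have "continuous_on {-1..1} q"
    unfolding q_def
  proof (intro continuous_intros)
    show "continuous_on {-1..1} (\<lambda>c. \<psi> (arccos c / pi))"
      by (rule continuous_on_compose2[OF cont])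
         (auto intro!: continuous_intros arccos_lbound arccos_ubound divide_nonneg_pos simp: divide_le_eq)
    show "\<forall>c\<in>{-1..1}. 1 - c\<^sup>2 + d \<noteq> 0" using pos by force
  qed
  then obtain g where g: "real_polynomial_function g" "\<And>c. c \<in> {-1..1} \<Longrightarrow> \<bar>q c - g c\<bar> < e / 2"
    using Stone_Weierstrass_real_polynomial_function[of "{-1..1}" q "e/2"] e by auto
  then obtain a n where an: "g = (\<lambda>c. \<Sum>i\<le>n. a i * c ^ i)"
    by (auto simp: real_polynomial_function_iff_sum)
  show ?thesis
  proof (rule that)
    show "sine_poly (\<lambda>x. sin (pi * x) * g (cos (pi * x)))"
      unfolding an by (rule sine_poly_polynomial)
    fix x :: real assume x: "x \<in> {0..1}"
    define s where "s = sin (pi * x)"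
    have s: "0 \<le> s" "s \<le> 1" using sin_nonneg[OF x] by (auto simp: s_def)
    have c: "cos (pi * x) \<in> {-1..1}" by auto
    have c2: "1 - (cos (pi * x))\<^sup>2 = s\<^sup>2" by (simp add: s_def sin_squared_eq)
    have "arccos (cos (pi * x)) = pi * x" using x by (intro arccos_cos) (auto simp: mult_left_le)
    then have q: "s * q (cos (pi * x)) = \<psi> x * s\<^sup>2 / (s\<^sup>2 + d)"
      using s unfolding q_def c2 by (simp add: power2_eq_square)
    have "\<bar>s * q (cos (pi * x)) - s * g (cos (pi * x))\<bar> = s * \<bar>q (cos (pi * x)) - g (cos (pi * x))\<bar>"
      using s by (simp add: abs_mult right_diff_distrib[symmetric])
    also have "\<dots> \<le> 1 * (e / 2)" using s g(2)[OF c] by (intro mult_mono) auto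
    finally have 1: "\<bar>s * q (cos (pi * x)) - s * g (cos (pi * x))\<bar> \<le> e / 2" by simp
    have sd: "0 < s\<^sup>2 + d" using d by (simp add: add_nonneg_pos)
    have "\<psi> x - s * q (cos (pi * x)) = \<psi> x * (d / (s\<^sup>2 + d))"
      unfolding q using sd by (simp add: field_simps)
    then have "\<bar>\<psi> x - s * q (cos (pi * x))\<bar> = \<bar>\<psi> x\<bar> * (d / (s\<^sup>2 + d))"
      using sd d by (simp add: abs_mult)
    also have "\<dots> \<le> e / 2"
    \<comment> \<open>The relative error d / (s^2 + d) is small where |\<psi>| is large, and
      harmless elsewhere because it never exceeds 1.\<close>
    proof (cases "e / 2 \<le> \<bar>\<psi> x\<bar>")
      case True
      have "m \<le> s\<^sup>2" using m(2)[OF x True] by (simp add: s_def)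
      then have "d / (s\<^sup>2 + d) \<le> d / m" using d m sd by (intro divide_left_mono mult_pos_pos) auto
      then have "\<bar>\<psi> x\<bar> * (d / (s\<^sup>2 + d)) \<le> B * (d / m)"
        using B(2)[OF x] B(1) d sd by (intro mult_mono) auto
      also have "\<dots> = e / 2" using m B by (simp add: d_def)
      finally show ?thesis .
    next
      case False
      have "d / (s\<^sup>2 + d) \<le> 1" using sd by simp
      then have "\<bar>\<psi> x\<bar> * (d / (s\<^sup>2 + d)) \<le> \<bar>\<psi> x\<bar> * 1" by (intro mult_left_mono) auto
      then show ?thesis using False by linarith
    qed
    finally show "\<bar>\<psi> x - sin (pi * x) * g (cos (pi * x))\<bar> \<le> e"
      using 1 unfolding s_def[symmetric] by linarith
  qed
qed

section \<open>Explicit evolutions of sine modes\<close>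

text \<open>Factoring out the larger exponential leaves 1 - exp (-z) \<le> z.\<close>

lemma exp_decay_diff:
  fixes a b t :: real
  assumes "0 \<le> a" "0 \<le> b" "0 \<le> t"
  shows "\<bar>exp (- a * t) - exp (- b * t)\<bar> \<le> \<bar>a - b\<bar> * t"
proof -
  have *: "exp (- a * t) - exp (- b * t) \<le> (b - a) * t" "0 \<le> exp (- a * t) - exp (- b * t)"
    if "0 \<le> a" "a \<le> b" for a b :: real
  proof -
    have "1 - exp (- ((b - a) * t)) \<le> (b - a) * t"
      using exp_ge_add_one_self[of "- ((b - a) * t)"] by simp
    moreover have "0 \<le> 1 - exp (- ((b - a) * t))" using that assms(3) by simp
    moreover have "exp (- a * t) - exp (- b * t) = exp (- a * t) * (1 - exp (- ((b - a) * t)))"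
      by (simp add: right_diff_distrib exp_add[symmetric] algebra_simps)
    moreover have "exp (- a * t) \<le> 1" using that assms(3) by simp
    ultimately show "exp (- a * t) - exp (- b * t) \<le> (b - a) * t" "0 \<le> exp (- a * t) - exp (- b * t)"
      using mult_left_le_one_le[of "1 - exp (- ((b - a) * t))" "exp (- a * t)"] by auto
  qed
  show ?thesis
    using *[of a b] *[of b a] assms by (cases "a \<le> b") auto
qed

text \<open>1 - cos (b / L) is the decay rate of the sampled mode sin (b x / L) under half the
  discrete Laplacian; speeding time up by L^2 yields the continuous rate in the limit.\<close>

lemma discrete_eigenvalue_limit:
  "(\<lambda>L. (real L)\<^sup>2 * (1 - cos (b / real L))) \<longlonglongrightarrow> b\<^sup>2 / 2"
  unfolding power2_eq_square by real_asymp

text \<open>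
  \<open>F\<close> solves the heat equation and \<open>G\<close> its discretisations, both started from \<open>f\<close> with zero boundary
  values, and \<open>G\<close> converges to \<open>F\<close> under diffusive scaling.
\<close>

definition heat_pair ::
    "(real \<Rightarrow> real) \<Rightarrow> (real \<Rightarrow> real \<Rightarrow> real) \<Rightarrow> (nat \<Rightarrow> nat \<Rightarrow> real \<Rightarrow> real) \<Rightarrow> bool" where
  "heat_pair f F G \<longleftrightarrow> heat_eq F \<and> (\<forall>t. F 0 t = 0 \<and> F 1 t = 0) \<and> (\<forall>x. F x 0 = f x)
    \<and> (\<forall>L x t. 0 < x \<longrightarrow>
        (G L x has_real_derivative (G L (x + 1) t + G L (x - 1) t - 2 * G L x t) / 2) (at t))
    \<and> (\<forall>L t. G L 0 t = 0 \<and> G L L t = 0) \<and> (\<forall>L x. G L x 0 = f (real x / real L))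
    \<and> (\<forall>T\<ge>0. \<exists>e. e \<longlonglongrightarrow> 0 \<and> (\<forall>L x t. 0 \<le> t \<longrightarrow> t \<le> T \<longrightarrow>
        \<bar>G L x ((real L)\<^sup>2 * t) - F (real x / real L) t\<bar> \<le> e L))"

lemma heat_pairD:
  assumes "heat_pair f F G"
  shows "heat_eq F" "F 0 t = 0" "F 1 t = 0" "F x 0 = f x"
    "0 < y \<Longrightarrow> (G L y has_real_derivative (G L (y + 1) t + G L (y - 1) t - 2 * G L y t) / 2) (at t)"
    "G L 0 t = 0" "G L L t = 0" "G L y 0 = f (real y / real L)"
    "0 \<le> T \<Longrightarrow> \<exists>e. e \<longlonglongrightarrow> 0 \<and> (\<forall>L x t. 0 \<le> t \<longrightarrow> t \<le> T \<longrightarrow>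
        \<bar>G L x ((real L)\<^sup>2 * t) - F (real x / real L) t\<bar> \<le> e L)"
  using assms unfolding heat_pair_def by blast+

lemma heat_pair_zero: "heat_pair (\<lambda>x. 0) (\<lambda>x t. 0) (\<lambda>L x t. 0)"
  unfolding heat_pair_def
proof (intro conjI allI impI)
  show "heat_eq (\<lambda>x t. 0)" using heat_eq_affine[of 0 0] by simp
  show "\<exists>e. e \<longlonglongrightarrow> 0 \<and> (\<forall>(L::nat) (x::nat) t. 0 \<le> t \<longrightarrow> t \<le> T \<longrightarrow> \<bar>(0::real) - 0\<bar> \<le> e L)" for T :: real
    by (rule exI[of _ "\<lambda>_. 0"]) simp
qed simp_all

text \<open>Sampled sines are exact eigenfunctions of the discrete Laplacian, so the evolutions of
  the added mode differ only in their decay rates, and the added error up to time T is at most |c| T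
  times the difference of the rates.\<close>

lemma heat_pair_add_mode:
  assumes FG: "heat_pair f F G"
  shows "\<exists>F' G'. heat_pair (\<lambda>x. f x + c * sin (real k * pi * x)) F' G'"
proof -
  define b where "b = real k * pi"
  define F' where "F' x t = F x t + c * (exp (- (b\<^sup>2 / 2) * t) * sin (b * x))" for x t
  define r where "r L = 1 - cos (b / real L)" for L :: nat
  define G' where "G' L x t = G L x t + c * (exp (- r L * t) * sin (b * (real x / real L)))" for L x t
  have sin_b: "sin b = 0" by (simp add: b_def)
  have "heat_pair (\<lambda>x. f x + c * sin (real k * pi * x)) F' G'"
    unfolding heat_pair_def
  proof (intro conjI allI impI)
    show "heat_eq F'" unfolding F'_def by (intro heat_eq_add heat_eq_cmult heat_eq_sine heat_pairD(1)[OF FG])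
    show "F' 0 t = 0" "F' 1 t = 0" for t using heat_pairD[OF FG] sin_b by (auto simp: F'_def)
    show "F' x 0 = f x + c * sin (real k * pi * x)" for x using heat_pairD(4)[OF FG] by (simp add: F'_def b_def)
    \<comment> \<open>For L = 0 the quotient by zero is 0, and the sine vanishes as well.\<close>
    show "G' L 0 t = 0" "G' L L t = 0" for L t
      using heat_pairD(6,7)[OF FG] sin_b by (cases "L = 0"; simp add: G'_def)+
    show "G' L x 0 = f (real x / real L) + c * sin (real k * pi * (real x / real L))" for L x
      using heat_pairD(8)[OF FG] by (simp add: G'_def b_def)
  next
    fix L x :: nat and t :: real assume x: "0 < x"
    define z where "z = b * (real x / real L)"
    define a where "a = b / real L"
    have zp: "b * (real (x + 1) / real L) = z + a" "b * (real (x - 1) / real L) = z - a"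
      using x by (auto simp: z_def a_def algebra_simps add_divide_distrib diff_divide_distrib)
    have s: "sin (z + a) + sin (z - a) - 2 * sin z = - 2 * r L * sin z"
      by (simp add: sin_add sin_diff r_def a_def algebra_simps)
    have D: "(G' L x has_real_derivative (G L (x + 1) t + G L (x - 1) t - 2 * G L x t) / 2
        + c * (- r L * exp (- r L * t) * sin z)) (at t)"
      unfolding G'_def z_def[symmetric]
      by (intro DERIV_add heat_pairD(5)[OF FG] x DERIV_cmult) (auto intro!: derivative_eq_intros)
    have E: "(G' L (x + 1) t + G' L (x - 1) t - 2 * G' L x t) / 2
        = (G L (x + 1) t + G L (x - 1) t - 2 * G L x t) / 2
          + c * exp (- r L * t) * (sin (z + a) + sin (z - a) - 2 * sin z) / 2"
      unfolding G'_def zp z_def[symmetric] by (simp add: field_simps)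
    show "(G' L x has_real_derivative (G' L (x + 1) t + G' L (x - 1) t - 2 * G' L x t) / 2) (at t)"
      by (rule DERIV_cong[OF D]) (simp only: E s, simp)
  next
    fix T :: real assume T: "0 \<le> T"
    then obtain e where e: "e \<longlonglongrightarrow> 0" "\<And>L x t. 0 \<le> t \<Longrightarrow> t \<le> T \<Longrightarrow>
        \<bar>G L x ((real L)\<^sup>2 * t) - F (real x / real L) t\<bar> \<le> e L"
      using heat_pairD(9)[OF FG T] by blast
    define e' where "e' L = e L + \<bar>c\<bar> * (\<bar>(real L)\<^sup>2 * r L - b\<^sup>2 / 2\<bar> * T)" for L
    have "(\<lambda>L. e L + \<bar>c\<bar> * (\<bar>(real L)\<^sup>2 * r L - b\<^sup>2 / 2\<bar> * T)) \<longlonglongrightarrow> 0 + \<bar>c\<bar> * (\<bar>b\<^sup>2 / 2 - b\<^sup>2 / 2\<bar> * T)"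
      unfolding r_def by (intro tendsto_intros e(1) discrete_eigenvalue_limit)
    then have "e' \<longlonglongrightarrow> 0" by (simp add: e'_def[abs_def])
    moreover have "\<bar>G' L x ((real L)\<^sup>2 * t) - F' (real x / real L) t\<bar> \<le> e' L"
      if t: "0 \<le> t" "t \<le> T" for L x t
    proof -
      define E where "E = exp (- ((real L)\<^sup>2 * r L) * t) - exp (- (b\<^sup>2 / 2) * t)"
      have "\<bar>E\<bar> \<le> \<bar>(real L)\<^sup>2 * r L - b\<^sup>2 / 2\<bar> * t"
        unfolding E_def using t by (intro exp_decay_diff) (auto simp: r_def)
      also have "\<dots> \<le> \<bar>(real L)\<^sup>2 * r L - b\<^sup>2 / 2\<bar> * T" using t by (intro mult_left_mono) auto
      finally have E: "\<bar>E\<bar> \<le> \<bar>(real L)\<^sup>2 * r L - b\<^sup>2 / 2\<bar> * T" .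
      have "\<bar>c * (E * sin (b * (real x / real L)))\<bar> = \<bar>c\<bar> * (\<bar>E\<bar> * \<bar>sin (b * (real x / real L))\<bar>)"
        by (simp only: abs_mult)
      also have "\<dots> \<le> \<bar>c\<bar> * (\<bar>E\<bar> * 1)" by (intro mult_left_mono) auto
      also have "\<dots> \<le> \<bar>c\<bar> * (\<bar>(real L)\<^sup>2 * r L - b\<^sup>2 / 2\<bar> * T)"
        using E by (intro mult_left_mono) auto
      finally have "\<bar>c * (E * sin (b * (real x / real L)))\<bar> \<le> \<bar>c\<bar> * (\<bar>(real L)\<^sup>2 * r L - b\<^sup>2 / 2\<bar> * T)" .
      moreover have "G' L x ((real L)\<^sup>2 * t) - F' (real x / real L) t
          = (G L x ((real L)\<^sup>2 * t) - F (real x / real L) t) + c * (E * sin (b * (real x / real L)))"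
        by (simp add: G'_def F'_def E_def algebra_simps)
      ultimately show ?thesis using e(2)[OF t, of L x] unfolding e'_def by linarith
    qed
    ultimately show "\<exists>e. e \<longlonglongrightarrow> 0 \<and> (\<forall>L x t. 0 \<le> t \<longrightarrow> t \<le> T \<longrightarrow>
        \<bar>G' L x ((real L)\<^sup>2 * t) - F' (real x / real L) t\<bar> \<le> e L)" by blast
  qed
  then show ?thesis by blast
qed

lemma sine_poly_heat_pair: "sine_poly f \<Longrightarrow> \<exists>F G. heat_pair f F G"
  by (induction rule: sine_poly.induct) (use heat_pair_zero heat_pair_add_mode in blast)+

section \<open>Comparison of the discrete and continuous solutions\<close>

text \<open>Four errors of \<epsilon> / 4 relative to L: the initial approximation carried by the
  discrete principle, the same carried by the continuous principle, the error of the explicit modes,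
  and the rounding 2 of the initial heights, absorbed once L \<ge> 8 / \<epsilon>.\<close>

lemma discrete_heat_convergence:
  fixes u :: "nat \<Rightarrow> nat \<Rightarrow> real \<Rightarrow> real"
  assumes heat: "heat_solution phi0 phi" and zero: "phi0 0 = 0"
    and deriv: "\<And>L x t. x \<in> {1..<L} \<Longrightarrow>
        (u L x has_real_derivative (u L (x + 1) t + u L (x - 1) t - 2 * u L x t) / 2) (at t)"
    and init: "\<And>L x. 0 < L \<Longrightarrow> x \<le> L \<Longrightarrow> \<bar>u L x 0 - real L * phi0 (real x / real L)\<bar> \<le> 2"
    and bdry: "\<And>L t. u L 0 t = u L 0 0" "\<And>L t. u L L t = u L L 0"
    and T: "0 \<le> T" and eps: "0 < \<epsilon>"
  shows "\<forall>\<^sub>F L in sequentially. \<forall>x\<le>L. \<forall>t\<in>{0..T}.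
    \<bar>u L x ((real L)\<^sup>2 * t) - real L * phi (real x / real L) t\<bar> \<le> \<epsilon> * real L"
proof -
  have phi: "heat_eq phi" and phi_bdry: "\<And>t. 0 < t \<Longrightarrow> phi 0 t = 0" "\<And>t. 0 < t \<Longrightarrow> phi 1 t = phi0 1"
    and phi_init: "\<And>x. x \<in> {0..1} \<Longrightarrow> phi x 0 = phi0 x"
    using heat by (auto simp: heat_solution_def heat_eq_def)
  have "continuous_on {0..1} (\<lambda>x. (\<lambda>(x, t). phi x t) (x, 0))"
    by (rule continuous_on_compose2[OF heat_eq_continuous[OF phi]]) (auto intro!: continuous_intros)
  then have cont: "continuous_on {0..1} phi0"
    by (subst continuous_on_cong[OF refl, of _ _ "\<lambda>x. phi x 0"]) (auto simp: phi_init)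
  \<comment> \<open>Subtracting the affine part makes both endpoint values vanish, and affine
    functions are stationary for both evolutions.\<close>
  obtain f where f: "sine_poly f" "\<And>x. x \<in> {0..1} \<Longrightarrow> \<bar>(phi0 x - x * phi0 1) - f x\<bar> \<le> \<epsilon> / 4"
  proof (rule sine_poly_approx[of "\<lambda>x. phi0 x - x * phi0 1" "\<epsilon> / 4"])
    show "continuous_on {0..1} (\<lambda>x. phi0 x - x * phi0 1)" by (intro continuous_intros cont)
  qed (use zero eps in auto)
  obtain F G where FG: "heat_pair f F G" using sine_poly_heat_pair[OF f(1)] by blast
  note F = heat_pairD(1-4)[OF FG] and G = heat_pairD(5-8)[OF FG]
  obtain e where e: "e \<longlonglongrightarrow> 0" "\<And>L x t. 0 \<le> t \<Longrightarrow> t \<le> T \<Longrightarrow>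
        \<bar>G L x ((real L)\<^sup>2 * t) - F (real x / real L) t\<bar> \<le> e L" using heat_pairD(9)[OF FG T] by blast
  have phiF: "\<bar>phi x t - (x * phi0 1 + F x t)\<bar> \<le> \<epsilon> / 4" if "x \<in> {0..1}" "0 \<le> t" for x t
  proof -
    have "\<bar>(phi x t + (-1) * F x t) + (0 + (- phi0 1) * x)\<bar> \<le> \<epsilon> / 4"
    proof (rule heat_eq_bound[where w = "\<lambda>x t. (phi x t + (-1) * F x t) + (0 + (- phi0 1) * x)", OF _ _ _ _ that])
      show "heat_eq (\<lambda>x t. (phi x t + (-1) * F x t) + (0 + (- phi0 1) * x))"
        by (intro heat_eq_add heat_eq_affine heat_eq_cmult phi F)
      show "\<bar>(phi x 0 + (-1) * F x 0) + (0 + (- phi0 1) * x)\<bar> \<le> \<epsilon> / 4" if "x \<in> {0..1}" for x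
        using f(2)[OF that] by (simp add: phi_init[OF that] F algebra_simps)
    qed (auto simp: phi_bdry F)
    then show ?thesis by (simp add: algebra_simps)
  qed
  have uG: "\<bar>u L x t - (real x * phi0 1 + real L * G L x t)\<bar> \<le> 2 + \<epsilon> / 4 * real L"
    if L: "0 < L" and x: "x \<le> L" and t: "0 \<le> t" for L x t
  proof -
    define d where "d x t = u L x t - (real x * phi0 1 + real L * G L x t)" for x t
    have d_init: "\<bar>d x 0\<bar> \<le> 2 + \<epsilon> / 4 * real L" if "x \<le> L" for x
    proof -
      have "real x / real L \<in> {0..1}" using L that by auto
      then have "\<bar>real L * ((phi0 (real x / real L) - real x / real L * phi0 1) - f (real x / real L))\<bar> \<le> real L * (\<epsilon> / 4)"
        using f(2)[of "real x / real L"] unfolding abs_mult by (intro mult_mono) auto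
      moreover have "real L * ((phi0 (real x / real L) - real x / real L * phi0 1) - f (real x / real L))
          = real L * phi0 (real x / real L) - (real x * phi0 1 + real L * f (real x / real L))"
        using L by (simp add: algebra_simps)
      ultimately have "\<bar>real L * phi0 (real x / real L) - (real x * phi0 1 + real L * f (real x / real L))\<bar>
          \<le> real L * (\<epsilon> / 4)" by (simp only:)
      then show ?thesis using init[OF L that] unfolding d_def G(4) mult.commute[of "\<epsilon> / 4"] by linarith
    qed
    have d_bdry: "d 0 t = d 0 0" "d L t = d L 0" for t
      using bdry[of L t] by (simp_all add: d_def G(2,3))
    have "0 \<le> (2 + \<epsilon> / 4 * real L) + c * d x t" if c: "c \<in> {-1, 1}" for c
    proof (rule discrete_heat_min_principle[where v = "\<lambda>x t. (2 + \<epsilon> / 4 * real L) + c * d x t"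
          and v' = "\<lambda>x t. c * ((u L (x + 1) t + u L (x - 1) t - 2 * u L x t) / 2
            - real L * ((G L (x + 1) t + G L (x - 1) t - 2 * G L x t) / 2))", OF _ _ _ _ _ x t])
      fix x t assume x: "x \<in> {1..<L}"
      show "((\<lambda>t. 2 + \<epsilon> / 4 * real L + c * d x t) has_real_derivative
         c * ((u L (x + 1) t + u L (x - 1) t - 2 * u L x t) / 2
            - real L * ((G L (x + 1) t + G L (x - 1) t - 2 * G L x t) / 2))) (at t)"
        unfolding d_def
        by (rule derivative_eq_intros deriv[OF x] G(1) refl)+ (use x in auto)
      have r: "real (x + 1) = real x + 1" "real (x - 1) = real x - 1" using x by auto
      have "(d (x + 1) t + d (x - 1) t - 2 * d x t) / 2 = (u L (x + 1) t + u L (x - 1) t - 2 * u L x t) / 2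
            - real L * ((G L (x + 1) t + G L (x - 1) t - 2 * G L x t) / 2)"
        unfolding d_def r by (simp add: field_simps)
      moreover have "(B + c * d (x + 1) t + (B + c * d (x - 1) t) - 2 * (B + c * d x t)) / 2
          = c * ((d (x + 1) t + d (x - 1) t - 2 * d x t) / 2)" for B
        by (simp add: field_simps)
      ultimately have "(B + c * d (x + 1) t + (B + c * d (x - 1) t) - 2 * (B + c * d x t)) / 2
          = c * ((u L (x + 1) t + u L (x - 1) t - 2 * u L x t) / 2
            - real L * ((G L (x + 1) t + G L (x - 1) t - 2 * G L x t) / 2))" for B
        by (simp only:)
      then show "(2 + \<epsilon> / 4 * real L + c * d (x + 1) t + (2 + \<epsilon> / 4 * real L + c * d (x - 1) t)
            - 2 * (2 + \<epsilon> / 4 * real L + c * d x t)) / 2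
          \<le> c * ((u L (x + 1) t + u L (x - 1) t - 2 * u L x t) / 2
            - real L * ((G L (x + 1) t + G L (x - 1) t - 2 * G L x t) / 2))"
        by (simp only: order_refl)
    next
      have *: "0 \<le> 2 + \<epsilon> / 4 * real L + c * d x 0" if "x \<le> L" for x
        using d_init[OF that] c by auto
      show "0 \<le> 2 + \<epsilon> / 4 * real L + c * d x 0" if "x \<le> L" for x by (rule *[OF that])
      show "0 \<le> 2 + \<epsilon> / 4 * real L + c * d 0 t" for t using *[of 0] d_bdry(1)[of t] by simp
      show "0 \<le> 2 + \<epsilon> / 4 * real L + c * d L t" for t using *[of L] d_bdry(2)[of t] by simp
    qed
    from this[of 1] this[of "-1"] show ?thesis unfolding d_def[symmetric] by auto
  qed
  have "\<forall>\<^sub>F L in sequentially. e L < \<epsilon> / 4"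
    using eps by (intro order_tendstoD(2)[OF e(1)]) auto
  moreover have "\<forall>\<^sub>F L in sequentially. 8 / \<epsilon> \<le> real L"
    by (metis eventually_sequentiallyI filterlim_at_top filterlim_real_sequentially)
  moreover have "\<forall>\<^sub>F L in sequentially. 0 < L" by (rule eventually_gt_at_top)
  ultimately show ?thesis
  proof eventually_elim
    fix L assume eL: "e L < \<epsilon> / 4" and L: "8 / \<epsilon> \<le> real L" "0 < L"
    show "\<forall>x\<le>L. \<forall>t\<in>{0..T}.
      \<bar>u L x ((real L)\<^sup>2 * t) - real L * phi (real x / real L) t\<bar> \<le> \<epsilon> * real L"
    proof (intro allI impI ballI)
      fix x t assume x: "x \<le> L" and t: "t \<in> {0..T}"
      define y where "y = real x / real L"
      have y: "y \<in> {0..1}" "real L * y = real x" using x L by (auto simp: y_def)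
      have 1: "\<bar>u L x ((real L)\<^sup>2 * t) - (real x * phi0 1 + real L * G L x ((real L)\<^sup>2 * t))\<bar> \<le> 2 + \<epsilon> / 4 * real L"
        using uG[OF L(2) x, of "(real L)\<^sup>2 * t"] t by auto
      have scale: "\<bar>real L * z\<bar> \<le> real L * (\<epsilon> / 4)" if "\<bar>z\<bar> \<le> \<epsilon> / 4" for z
        unfolding abs_mult using that by (intro mult_mono) auto
      have 2: "\<bar>real L * (G L x ((real L)\<^sup>2 * t) - F y t)\<bar> \<le> real L * (\<epsilon> / 4)"
        using e(2)[of t L x] eL t by (intro scale) (simp add: y_def)
      have 3: "\<bar>real L * (phi y t - (y * phi0 1 + F y t))\<bar> \<le> real L * (\<epsilon> / 4)"
        using t by (intro scale phiF y) auto
      have 4: "2 \<le> real L * (\<epsilon> / 4)" using L eps by (simp add: field_simps)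
      have eq: "u L x ((real L)\<^sup>2 * t) - real L * phi y t
          = (u L x ((real L)\<^sup>2 * t) - (real x * phi0 1 + real L * G L x ((real L)\<^sup>2 * t)))
            + real L * (G L x ((real L)\<^sup>2 * t) - F y t) - real L * (phi y t - (y * phi0 1 + F y t))"
        unfolding y(2)[symmetric] by (simp add: algebra_simps)
      have bound3: "\<bar>z\<bar> \<le> 4 * q" if "z = a + b - c" "\<bar>a\<bar> \<le> 2 + q" "\<bar>b\<bar> \<le> q" "\<bar>c\<bar> \<le> q" "2 \<le> q"
        for z a b c q :: real using that by linarith
      have "\<bar>u L x ((real L)\<^sup>2 * t) - real L * phi y t\<bar> \<le> 4 * (real L * (\<epsilon> / 4))"
        by (rule bound3[OF eq 1[unfolded mult.commute[of "\<epsilon> / 4"]] 2 3 4])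
      then show "\<bar>u L x ((real L)\<^sup>2 * t) - real L * phi (real x / real L) t\<bar> \<le> \<epsilon> * real L"
        unfolding y_def[symmetric] by (simp add: mult.commute)
    qed
  qed
qed

section \<open>The hydrodynamic limit\<close>

text \<open>Rounding down to the prescribed parity loses less than 2. As the unrounded values differ
  by at most 1, neighbouring heights differ by less than 3, and by an odd number since their
  parities differ.\<close>

lemma init_profile_step:
  assumes lip: "\<forall>x\<in>{0..1}. \<forall>y\<in>{0..1}. \<bar>phi0 x - phi0 y\<bar> \<le> \<bar>x - y\<bar>" and x: "x < L"
  shows "\<bar>init_profile phi0 L (Suc x) - init_profile phi0 L x\<bar> = 1"
proof -
  define u where "u = real L * phi0 (real x / real L)"
  define v where "v = real L * phi0 (real (Suc x) / real L)"
  have "\<bar>phi0 (real (Suc x) / real L) - phi0 (real x / real L)\<bar> \<le> \<bar>real (Suc x) / real L - real x / real L\<bar>"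
    using x by (intro lip[rule_format]) auto
  also have "\<dots> = 1 / real L" by (simp add: diff_divide_distrib[symmetric])
  finally have "real L * \<bar>phi0 (real (Suc x) / real L) - phi0 (real x / real L)\<bar> \<le> real L * (1 / real L)"
    by (intro mult_left_mono) auto
  then have uv: "\<bar>v - u\<bar> \<le> 1" using x by (simp add: u_def v_def right_diff_distrib[symmetric] abs_mult)
  show ?thesis
  proof (cases "even x")
    case True
    define a b where "a = \<lfloor>u / 2\<rfloor>" and "b = \<lfloor>(v - 1) / 2\<rfloor>"
    have "real_of_int a \<le> u / 2" "u / 2 < real_of_int a + 1"
      "real_of_int b \<le> (v - 1) / 2" "(v - 1) / 2 < real_of_int b + 1"
      unfolding a_def b_def by linarith+
    then have "real_of_int b < real_of_int (a + 1)" "real_of_int (a - 2) < real_of_int b"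
      using uv by (auto simp: abs_le_iff field_simps)
    then have "b < a + 1" "a - 2 < b" by linarith+
    then have "\<bar>(2 * b + 1) - 2 * a\<bar> = 1" by presburger
    then show ?thesis using True x by (simp add: init_profile_def a_def b_def u_def v_def)
  next
    case False
    define a b where "a = \<lfloor>(u - 1) / 2\<rfloor>" and "b = \<lfloor>v / 2\<rfloor>"
    have "real_of_int a \<le> (u - 1) / 2" "(u - 1) / 2 < real_of_int a + 1"
      "real_of_int b \<le> v / 2" "v / 2 < real_of_int b + 1"
      unfolding a_def b_def by linarith+
    then have "real_of_int b < real_of_int (a + 2)" "real_of_int (a - 1) < real_of_int b"
      using uv by (auto simp: abs_le_iff field_simps)
    then have "b < a + 2" "a - 1 < b" by linarith+
    then have "\<bar>2 * b - (2 * a + 1)\<bar> = 1" by presburger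
    then show ?thesis using False x by (simp add: init_profile_def a_def b_def u_def v_def)
  qed
qed

lemma init_profile_close:
  assumes "x \<le> L"
  shows "\<bar>real_of_int (init_profile phi0 L x) - real L * phi0 (real x / real L)\<bar> \<le> 2"
proof -
  define u where "u = real L * phi0 (real x / real L)"
  have "real_of_int \<lfloor>u / 2\<rfloor> \<le> u / 2" "u / 2 < real_of_int \<lfloor>u / 2\<rfloor> + 1"
    "real_of_int \<lfloor>(u - 1) / 2\<rfloor> \<le> (u - 1) / 2" "(u - 1) / 2 < real_of_int \<lfloor>(u - 1) / 2\<rfloor> + 1"
    by linarith+
  then show ?thesis
    unfolding init_profile_def u_def[symmetric] using assms by (auto simp: abs_le_iff field_simps)
qed

context
  fixes phi0 :: "real \<Rightarrow> real" and L :: nat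
  assumes lip: "\<forall>x\<in>{0..1}. \<forall>y\<in>{0..1}. \<bar>phi0 x - phi0 y\<bar> \<le> \<bar>x - y\<bar>"
    and zero: "phi0 0 = 0"
begin

text \<open>Together these make half of L plus the final height an integer between 0 and L, so that
  \<open>M_L\<close> involves neither truncation nor rounding.\<close>

lemma init_profile_end: "\<bar>init_profile phi0 L L\<bar> \<le> int L" "even (int L + init_profile phi0 L L)"
proof -
  have "\<bar>init_profile phi0 L x\<bar> \<le> int x" if "x \<le> L" for x
    using that
  proof (induction x)
    case 0
    then show ?case using zero by (simp add: init_profile_def)
  next
    case (Suc x)
    then show ?case using init_profile_step[OF lip, of x L] by simp
  qed
  then show "\<bar>init_profile phi0 L L\<bar> \<le> int L" by simp
  show "even (int L + init_profile phi0 L L)" by (simp add: init_profile_def)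
qed

lemma M_L_plus_N_L: "M_L phi0 L + N_L phi0 L = L"
proof -
  have "(l + k) div 2 \<le> l" if "\<bar>k\<bar> \<le> l" for k l :: int using that by presburger
  from this[OF init_profile_end(1)] have "(int L + init_profile phi0 L L) div 2 \<le> int L" .
  then show ?thesis by (simp add: M_L_def N_L_def nat_le_iff)
qed

lemma init_profile_in_Omega: "init_profile phi0 L \<in> Omega (M_L phi0 L) (N_L phi0 L)"
proof -
  have "int (M_L phi0 L) = (int L + init_profile phi0 L L) div 2"
    using init_profile_end(1) by (simp add: M_L_def)
  moreover have "int (M_L phi0 L) + int (N_L phi0 L) = int L"
    using M_L_plus_N_L by linarith
  moreover have "m - n = k" if "m = (l + k) div 2" "m + n = l" "even (l + k)" for m n k l :: int
    using that by presburger
  ultimately have "int (M_L phi0 L) - int (N_L phi0 L) = init_profile phi0 L L"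
    using init_profile_end(2) by blast
  moreover have "init_profile phi0 L 0 = 0" using zero by (simp add: init_profile_def)
  moreover have "init_profile phi0 L x = 0" if "L < x" for x using that by (simp add: init_profile_def)
  ultimately show ?thesis
    using init_profile_step[OF lip] by (simp add: Omega_def M_L_plus_N_L)
qed

end

section \<open>Time windows, union bound and measurability\<close>

lemma finite_markov_corner_flip:
  assumes "corner_flip_process P X M N \<xi>"
  shows "finite_markov (Omega M N) (cf_rate (M + N)) P X \<xi>"
proof -
  have "prob_space P" using assms by (simp add: corner_flip_process_def markov_chain_gen_def)
  then show ?thesis
    using assms q_matrix_corner_flip
    by (simp add: finite_markov_def finite_markov_axioms_def corner_flip_process_def)
qed

text \<open>The mean is frozen at the start of the window. Chebyshev at that time costs (M + N) /
  r^2 for a deviation r; the oscillation inside the window costs 8 (M + N) / r^2 for a displacement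
  2 r.\<close>

lemma window_deviation:
  assumes proc: "corner_flip_process P X M N \<xi>" and xi: "\<xi> \<in> Omega M N" and x: "x \<le> M + N"
    and r: "0 < r" and s: "0 \<le> s" and D: "0 < D" "D \<le> r\<^sup>2 / 4"
  shows "\<exists>W\<in>sets P. measure P W \<le> 9 * real (M + N) / r\<^sup>2 \<and>
    (\<forall>\<omega>\<in>space P - W. \<forall>t\<in>{s..s+D}.
        \<bar>real_of_int (X t \<omega> x) - corner_flip.mean M N \<xi> x s\<bar> \<le> 3 * r)"
proof -
  interpret cf: corner_flip M N "M + N" by unfold_locales
  interpret fm: finite_markov "Omega M N" "cf_rate (M + N)" P X \<xi>
    by (rule finite_markov_corner_flip[OF proc])
  define V where "V = {\<omega> \<in> space P. r \<le> \<bar>real_of_int (X s \<omega> x) - corner_flip.mean M N \<xi> x s\<bar>}"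
  have V: "V \<in> sets P" unfolding V_def
    by (rule fm.X_event[OF s, of "\<lambda>b. r \<le> \<bar>real_of_int (b x) - corner_flip.mean M N \<xi> x s\<bar>"])
  have "measure P V \<le> (\<Sum>b | b \<in> Omega M N \<and> r \<le> \<bar>real_of_int (b x) - corner_flip.mean M N \<xi> x s\<bar>.
      trans_prob (Omega M N) (cf_rate (M + N)) s \<xi> b)"
    unfolding V_def
    by (rule fm.marginal_le[OF s, of "\<lambda>b. r \<le> \<bar>real_of_int (b x) - corner_flip.mean M N \<xi> x s\<bar>"])
  also have "\<dots> \<le> real (M + N) / r\<^sup>2" by (rule cf.mean_deviation[OF xi x s r])
  finally have probV: "measure P V \<le> real (M + N) / r\<^sup>2" .
  obtain W where W: "W \<in> sets P" "measure P W \<le> 2 * (4 * real (M + N) / r\<^sup>2)"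
    "\<And>\<omega> t. \<omega> \<in> space P - W \<Longrightarrow> s \<le> t \<Longrightarrow> t \<le> s + D \<Longrightarrow>
        \<bar>real_of_int (X t \<omega> x) - real_of_int (X s \<omega> x)\<bar> \<le> 2 * r"
  proof (rule fm.oscillation_bound[OF s D(1), of r "\<lambda>b. real_of_int (b x)" "4 * real (M + N) / r\<^sup>2"])
    show "(\<Sum>y | y \<in> Omega M N \<and> r < \<bar>real_of_int (y x) - real_of_int (a x)\<bar>.
          trans_prob (Omega M N) (cf_rate (M + N)) u a y) \<le> 4 * real (M + N) / r\<^sup>2"
      if "a \<in> Omega M N" "0 \<le> u" "u \<le> D" for a u
      using that D(2) by (intro cf.displacement_deviation x r) auto
  qed (use r in auto)
  have "measure P (V \<union> W) \<le> measure P V + measure P W" by (rule measure_Un_le[OF V W(1)])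
  also have "\<dots> \<le> 9 * real (M + N) / r\<^sup>2"
    using probV W(2) unfolding times_divide_eq_right[symmetric] by linarith
  finally have "measure P (V \<union> W) \<le> 9 * real (M + N) / r\<^sup>2" .
  moreover have "\<bar>real_of_int (X t \<omega> x) - corner_flip.mean M N \<xi> x s\<bar> \<le> 3 * r"
    if w: "\<omega> \<in> space P - (V \<union> W)" and t: "t \<in> {s..s+D}" for \<omega> t
  proof -
    have "\<bar>real_of_int (X t \<omega> x) - real_of_int (X s \<omega> x)\<bar> \<le> 2 * r" using W(3) w t by auto
    moreover have "\<bar>real_of_int (X s \<omega> x) - corner_flip.mean M N \<xi> x s\<bar> < r"
      using w by (auto simp: V_def)
    ultimately show ?thesis by linarith
  qed
  ultimately show ?thesis using V W(1) by blast
qed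

text \<open>Exceptional sets are measurable while \<open>A\<close> is arbitrary, so statements about
  uncountably many times can be collected before asking whether they define events.\<close>

lemma finite_union_bound:
  assumes "finite I" "\<And>i. i \<in> I \<Longrightarrow> \<exists>W\<in>sets P. measure P W \<le> c \<and> (\<forall>\<omega>\<in>space P - W. A i \<omega>)"
    and "prob_space P"
  shows "\<exists>W\<in>sets P. measure P W \<le> real (card I) * c \<and> (\<forall>\<omega>\<in>space P - W. \<forall>i\<in>I. A i \<omega>)"
proof -
  interpret prob_space P by fact
  obtain W where W: "\<And>i. i \<in> I \<Longrightarrow> W i \<in> sets P" "\<And>i. i \<in> I \<Longrightarrow> measure P (W i) \<le> c"
    "\<And>i \<omega>. i \<in> I \<Longrightarrow> \<omega> \<in> space P - W i \<Longrightarrow> A i \<omega>"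
    using assms(2) by metis
  have "measure P (\<Union>i\<in>I. W i) \<le> (\<Sum>i\<in>I. measure P (W i))"
    using W(1) by (intro finite_measure_subadditive_finite assms(1)) auto
  also have "\<dots> \<le> real (card I) * c" using sum_bounded_above[of I "\<lambda>i. measure P (W i)" c] W(2) by simp
  finally show ?thesis using W assms(1) by (intro bexI[of _ "\<Union>i\<in>I. W i"]) auto
qed

text \<open>Right-continuity reduces the uncountable intersection over times to rational times.\<close>

lemma uniform_event_measurable:
  assumes proc: "corner_flip_process P X M N \<xi>"
    and cont: "continuous_on ({0..1} \<times> {0..}) (\<lambda>(x, t). phi x t)"
    and L: "0 < L" and T: "0 \<le> T"
  shows "{\<omega> \<in> space P. \<forall>t\<in>{0..T}. \<forall>x\<in>{0..1}.
        \<bar>real_of_int (X (real L ^ 2 * t) \<omega> (nat \<lfloor>x * real L\<rfloor>)) - real L * phi x t\<bar> / real L \<le> \<epsilon>} \<in> sets P"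
proof -
  interpret fm: finite_markov "Omega M N" "cf_rate (M + N)" P X \<xi>
    by (rule finite_markov_corner_flip[OF proc])
  define C where "C t b \<longleftrightarrow> (\<forall>x\<in>{0..1}.
      \<bar>real_of_int (b (nat \<lfloor>x * real L\<rfloor>)) - real L * phi x t\<bar> / real L \<le> \<epsilon>)" for t and b :: "nat \<Rightarrow> int"
  \<comment> \<open>\<open>T\<close> is inserted because it may be irrational and the interval
    contains no later time from which to approximate it.\<close>
  define D where "D = insert T (\<rat> \<inter> {0..T})"
  have D0: "0 \<le> t" if "t \<in> D" for t using that T by (auto simp: D_def)
  have "countable D" unfolding D_def by (intro countable_insert countable_Int1 countable_rat)
  then have ev: "{\<omega> \<in> space P. \<forall>t\<in>D. C t (X (real L ^ 2 * t) \<omega>)} \<in> sets P"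
    by (rule sets.sets_Collect_countable_All'[rotated]) (rule fm.X_event, simp add: D0)
  have "C t (X (real L ^ 2 * t) \<omega>)"
    if w: "\<omega> \<in> space P" "\<forall>t\<in>D. C t (X (real L ^ 2 * t) \<omega>)" and t: "t \<in> {0..T}" for \<omega> t
  proof (cases "t = T")
    case True
    then show ?thesis using w by (simp add: D_def)
  next
    case False
    then have tT: "t < T" using t by auto
    show ?thesis
    proof (rule ccontr)
      assume "\<not> C t (X (real L ^ 2 * t) \<omega>)"
      then obtain x where x: "x \<in> {0..1}"
        "\<epsilon> < \<bar>real_of_int (X (real L ^ 2 * t) \<omega> (nat \<lfloor>x * real L\<rfloor>)) - real L * phi x t\<bar> / real L"
        by (auto simp: C_def not_le)
      define a where "a = real_of_int (X (real L ^ 2 * t) \<omega> (nat \<lfloor>x * real L\<rfloor>))"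
      have "continuous_on {0..} (\<lambda>t. (\<lambda>(x, t). phi x t) (x, t))"
        by (rule continuous_on_compose2[OF cont]) (use x in \<open>auto intro!: continuous_intros\<close>)
      then have "continuous_on {0..} (\<lambda>s. \<bar>a - real L * phi x s\<bar> / real L)"
        using L by (intro continuous_intros) auto
      then have "((\<lambda>s. \<bar>a - real L * phi x s\<bar> / real L) \<longlongrightarrow> \<bar>a - real L * phi x t\<bar> / real L) (at t within {0..})"
        using t by (simp add: continuous_on_def)
      then have "\<forall>\<^sub>F s in at t within {0..}. \<epsilon> < \<bar>a - real L * phi x s\<bar> / real L"
        using x(2) unfolding a_def[symmetric] by (rule order_tendstoD(1))
      then obtain d where d: "d > 0" "\<And>s. s \<in> {0..} \<Longrightarrow> s \<noteq> t \<Longrightarrow> dist s t < d \<Longrightarrow>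
          \<epsilon> < \<bar>a - real L * phi x s\<bar> / real L"
        unfolding eventually_at by blast
      have "0 \<le> real L ^ 2 * t" using t by simp
      then obtain e where e: "e > 0" "\<And>s. real L ^ 2 * t \<le> s \<Longrightarrow> s < real L ^ 2 * t + e \<Longrightarrow>
          X s \<omega> = X (real L ^ 2 * t) \<omega>"
        using fm.X_right_const[OF w(1)] by blast
      \<comment> \<open>The three bounds keep s below T, keep \<open>phi\<close> close to its value
        at t, and keep the path from jumping; the last is divided by L^2 to undo the time
        scale.\<close>
      define c where "c = min (T - t) (min d (e / real L ^ 2))"
      have "0 < c" using tT d(1) e(1) L by (simp add: c_def)
      then obtain s where s: "s \<in> \<rat>" "t < s" "s < t + c" using Rats_dense_in_real[of t "t + c"] by auto
      have "s - t < e / real L ^ 2" using s by (simp add: c_def)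
      then have "real L ^ 2 * (s - t) < e" using L by (simp add: field_simps)
      then have "X (real L ^ 2 * s) \<omega> = X (real L ^ 2 * t) \<omega>"
        using s(2) by (intro e(2)) (auto simp: right_diff_distrib intro!: mult_left_mono)
      moreover have "\<epsilon> < \<bar>a - real L * phi x s\<bar> / real L"
        using s t by (intro d(2)) (auto simp: c_def dist_real_def)
      ultimately have "\<not> C s (X (real L ^ 2 * s) \<omega>)"
        using x(1) by (auto simp: C_def a_def not_le)
      moreover have "s \<in> D" using s t by (auto simp: D_def c_def)
      ultimately show False using w(2) by blast
    qed
  qed
  moreover have "D \<subseteq> {0..T}" using T by (auto simp: D_def)
  ultimately have "{\<omega> \<in> space P. \<forall>t\<in>{0..T}. C t (X (real L ^ 2 * t) \<omega>)}
      = {\<omega> \<in> space P. \<forall>t\<in>D. C t (X (real L ^ 2 * t) \<omega>)}"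
    by (intro Collect_cong conj_cong refl) (meson subsetD)
  then show ?thesis using ev unfolding C_def by (simp only:)
qed

theorem theorem3p1:
  fixes phi0 :: "real \<Rightarrow> real" and phi :: "real \<Rightarrow> real \<Rightarrow> real"
    and P :: "nat \<Rightarrow> 'w measure" and h :: "nat \<Rightarrow> real \<Rightarrow> 'w \<Rightarrow> nat \<Rightarrow> int"
  assumes lip: "\<forall>x\<in>{0..1}. \<forall>y\<in>{0..1}. \<bar>phi0 x - phi0 y\<bar> \<le> \<bar>x - y\<bar>"
    and zero: "phi0 0 = 0"
    and heat: "heat_solution phi0 phi"
    and dyn: "\<forall>L. corner_flip_process (P L) (h L) (M_L phi0 L) (N_L phi0 L) (init_profile phi0 L)"
  shows "\<forall>T\<ge>0. \<forall>\<epsilon>>0.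
    (\<lambda>L. measure (P L) {\<omega> \<in> space (P L). \<forall>t\<in>{0..T}. \<forall>x\<in>{0..1}.
        \<bar>real_of_int (h L (real L ^ 2 * t) \<omega> (nat \<lfloor>x * real L\<rfloor>)) - real L * phi x t\<bar> / real L \<le> \<epsilon>})
    \<longlonglongrightarrow> 1"
proof (intro allI impI)
  fix T \<epsilon> :: real
  assume T: "0 \<le> T" and eps: "0 < \<epsilon>"
  define E where "E L = {\<omega> \<in> space (P L). \<forall>t\<in>{0..T}. \<forall>x\<in>{0..1}.
      \<bar>real_of_int (h L (real L ^ 2 * t) \<omega> (nat \<lfloor>x * real L\<rfloor>)) - real L * phi x t\<bar> / real L \<le> \<epsilon>}" for L
  have prob: "prob_space (P L)" for L
    using dyn by (auto simp: corner_flip_process_def markov_chain_gen_def)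
  have phi: "continuous_on ({0..1} \<times> {0..}) (\<lambda>(x, t). phi x t)"
    using heat by (simp add: heat_solution_def)
  define u where "u L = corner_flip.mean (M_L phi0 L) (N_L phi0 L) (init_profile phi0 L)" for L
  note size_eq = M_L_plus_N_L[OF lip zero] and xi = init_profile_in_Omega[OF lip zero]
  \<comment> \<open>Seven shares of \<eta> L are spent: three on the window, two on the distance to
    a sampled site, one on the convergence of the mean and one on the modulus of continuity of
    \<open>phi\<close>.\<close>
  define \<eta> where "\<eta> = \<epsilon> / 8"
  have eta: "0 < \<eta>" using eps by (simp add: \<eta>_def)
  have "compact ({0..1::real} \<times> {0..T})" by (intro compact_Times compact_Icc)
  moreover have "continuous_on ({0..1} \<times> {0..T}) (\<lambda>(x, t). phi x t)"
    by (rule continuous_on_subset[OF phi]) auto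
  ultimately have "uniformly_continuous_on ({0..1} \<times> {0..T}) (\<lambda>(x, t). phi x t)"
    by (rule compact_uniformly_continuous[rotated])
  then obtain d where d: "0 < d" "\<And>p q. p \<in> {0..1} \<times> {0..T} \<Longrightarrow> q \<in> {0..1} \<times> {0..T} \<Longrightarrow>
      dist p q < d \<Longrightarrow> dist ((\<lambda>(x, t). phi x t) p) ((\<lambda>(x, t). phi x t) q) < \<eta>"
    using eta unfolding uniformly_continuous_on_def by metis
  have phi_close: "\<bar>phi x t - phi y s\<bar> \<le> \<eta>"
    if "x \<in> {0..1}" "y \<in> {0..1}" "t \<in> {0..T}" "s \<in> {0..T}" "\<bar>x - y\<bar> < d / 2" "\<bar>t - s\<bar> < d / 2" for x y t s
  proof -
    have "dist (x, t) (y, s) \<le> \<bar>x - y\<bar> + \<bar>t - s\<bar>"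
      unfolding dist_Pair_Pair dist_real_def by (rule sqrt_sum_squares_le_sum_abs[THEN order_trans]) simp
    then have "dist (x, t) (y, s) < d" using that by linarith
    then show ?thesis using d(2)[of "(x, t)" "(y, s)"] that by (simp add: dist_real_def)
  qed
  \<comment> \<open>\<theta> is the spatial mesh relative to L and \<delta> the window length
    relative to L^2. The bound \<eta>^2 / 4 is what \<open>window_deviation\<close> asks for at r =
    \<eta> L; the fractions of d keep 3 \<theta> and \<delta> below d / 2.\<close>
  define \<theta> where "\<theta> = min \<eta> (d / 8)"
  define \<delta> where "\<delta> = min (\<eta>\<^sup>2 / 4) (d / 4)"
  have theta: "0 < \<theta>" "\<theta> \<le> \<eta>" "\<theta> \<le> d / 8" and delta: "0 < \<delta>" "\<delta> \<le> \<eta>\<^sup>2 / 4" "\<delta> \<le> d / 4"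
    using eta d(1) by (auto simp: \<theta>_def \<delta>_def)
  \<comment> \<open>The index set of sites and windows does not depend on L, so the union bound
    costs only a constant factor.\<close>
  define I where "I = {..nat \<lfloor>1 / \<theta>\<rfloor>} \<times> {..nat \<lfloor>T / \<delta>\<rfloor>}"
  define K where "K = real (card I) * (9 / \<eta>\<^sup>2)"
  have mean_conv: "\<forall>\<^sub>F L in sequentially. \<forall>x\<le>L. \<forall>t\<in>{0..T}.
      \<bar>u L x ((real L)\<^sup>2 * t) - real L * phi (real x / real L) t\<bar> \<le> \<eta> * real L"
  proof (rule discrete_heat_convergence[OF heat zero _ _ _ _ T eta])
    fix L x :: nat and t :: real
    interpret cf: corner_flip "M_L phi0 L" "N_L phi0 L" "M_L phi0 L + N_L phi0 L" by unfold_locales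
    show "(u L x has_real_derivative (u L (x + 1) t + u L (x - 1) t - 2 * u L x t) / 2) (at t)"
      if "x \<in> {1..<L}" using cf.mean_deriv[OF xi, of x t] that by (simp add: u_def size_eq)
    show "\<bar>u L x 0 - real L * phi0 (real x / real L)\<bar> \<le> 2" if "x \<le> L"
      using init_profile_close[OF that, of phi0] by (simp add: u_def cf.mean_0[OF xi])
    show "u L 0 t = u L 0 0" by (simp add: u_def cf.mean_left[OF xi])
    show "u L L t = u L L 0" using cf.mean_right[OF xi] by (simp add: u_def size_eq)
  qed
  have "\<forall>\<^sub>F L in sequentially. 1 / \<theta> \<le> real L"
    by (metis eventually_sequentiallyI filterlim_at_top filterlim_real_sequentially)
  then have lower: "\<forall>\<^sub>F L in sequentially. 1 - K / real L \<le> measure (P L) (E L)"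
    using mean_conv eventually_gt_at_top[of 0]
  proof eventually_elim
    fix L :: nat
    assume Lth: "1 / \<theta> \<le> real L" and L: "0 < L" and conv: "\<forall>x\<le>L. \<forall>t\<in>{0..T}.
      \<bar>u L x ((real L)\<^sup>2 * t) - real L * phi (real x / real L) t\<bar> \<le> \<eta> * real L"
    interpret prob_space "P L" by (rule prob)
    have Lth': "1 \<le> \<theta> * real L" using Lth theta by (simp add: field_simps)
    \<comment> \<open>The mesh in lattice units. Rounding up at most doubles it because \<theta> L
      \<ge> 1.\<close>
    define m where "m = nat \<lceil>\<theta> * real L\<rceil>"
    have m: "\<theta> * real L \<le> real m" "real m \<le> 2 * \<theta> * real L" "0 < m"
      unfolding m_def using Lth' by linarith+
    \<comment> \<open>Multiples of m with index in the range of \<open>I\<close> may overshoot L;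
      they are capped at the last site.\<close>
    define pt where "pt i = min (m * i) L" for i
    define tm where "tm j = (real L)\<^sup>2 * (real j * \<delta>)" for j :: nat
    define A where "A = (\<lambda>(i, j) \<omega>. \<forall>t\<in>{tm j..tm j + (real L)\<^sup>2 * \<delta>}.
        \<bar>real_of_int (h L t \<omega> (pt i)) - u L (pt i) (tm j)\<bar> \<le> 3 * (\<eta> * real L))"
    have win: "\<exists>W\<in>sets (P L). measure (P L) W \<le> 9 / \<eta>\<^sup>2 / real L \<and>
        (\<forall>\<omega>\<in>space (P L) - W. A p \<omega>)" for p
    proof -
      obtain i j where p: "p = (i, j)" by fastforce
      have "\<exists>W\<in>sets (P L). measure (P L) W \<le> 9 * real (M_L phi0 L + N_L phi0 L) / (\<eta> * real L)\<^sup>2 \<and>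
        (\<forall>\<omega>\<in>space (P L) - W. \<forall>t\<in>{tm j..tm j + (real L)\<^sup>2 * \<delta>}.
        \<bar>real_of_int (h L t \<omega> (pt i))
          - corner_flip.mean (M_L phi0 L) (N_L phi0 L) (init_profile phi0 L) (pt i) (tm j)\<bar> \<le> 3 * (\<eta> * real L))"
      proof (rule window_deviation[OF dyn[rule_format] xi])
        show "pt i \<le> M_L phi0 L + N_L phi0 L" by (simp add: size_eq pt_def)
        show "0 < \<eta> * real L" using eta L by simp
        show "0 \<le> tm j" using delta by (simp add: tm_def)
        show "0 < (real L)\<^sup>2 * \<delta>" using L delta by simp
        show "(real L)\<^sup>2 * \<delta> \<le> (\<eta> * real L)\<^sup>2 / 4"
          using mult_left_mono[OF delta(2), of "(real L)\<^sup>2"] by (simp add: power_mult_distrib mult.commute)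
      qed
      moreover have "9 * real L / (\<eta> * real L)\<^sup>2 = 9 / \<eta>\<^sup>2 / real L"
        using L eta by (simp add: power2_eq_square field_simps)
      ultimately show ?thesis by (simp only: p A_def size_eq u_def prod.case)
    qed
    obtain W where W: "W \<in> sets (P L)" "measure (P L) W \<le> real (card I) * (9 / \<eta>\<^sup>2 / real L)"
      "\<And>\<omega> i j t. \<omega> \<in> space (P L) - W \<Longrightarrow> (i, j) \<in> I \<Longrightarrow> t \<in> {tm j..tm j + (real L)\<^sup>2 * \<delta>} \<Longrightarrow>
        \<bar>real_of_int (h L t \<omega> (pt i)) - u L (pt i) (tm j)\<bar> \<le> 3 * (\<eta> * real L)"
    proof -
      have "finite I" by (simp add: I_def)
      from finite_union_bound[OF this, of "P L" _ A, OF win prob] obtain W where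
        W: "W \<in> sets (P L)" "measure (P L) W \<le> real (card I) * (9 / \<eta>\<^sup>2 / real L)"
        and A: "\<forall>\<omega>\<in>space (P L) - W. \<forall>p\<in>I. A p \<omega>" by blast
      have "\<bar>real_of_int (h L t \<omega> (pt i)) - u L (pt i) (tm j)\<bar> \<le> 3 * (\<eta> * real L)"
        if "\<omega> \<in> space (P L) - W" "(i, j) \<in> I" "t \<in> {tm j..tm j + (real L)\<^sup>2 * \<delta>}" for \<omega> i j t
      proof -
        have "A (i, j) \<omega>" using A that by blast
        then show ?thesis using that(3) by (simp only: A_def prod.case)
      qed
      with W show ?thesis by (rule that)
    qed
    have "space (P L) - W \<subseteq> E L"
    proof
      fix \<omega> assume w: "\<omega> \<in> space (P L) - W"
      have "\<bar>real_of_int (h L (real L ^ 2 * t) \<omega> (nat \<lfloor>x * real L\<rfloor>)) - real L * phi x t\<bar> \<le> \<epsilon> * real L"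
        if t: "t \<in> {0..T}" and x: "x \<in> {0..1}" for t x
      proof -
        define k where "k = nat \<lfloor>x * real L\<rfloor>"
        have xL: "0 \<le> x * real L" "x * real L \<le> real L" using x by (auto simp: mult_left_le_one_le)
        have k: "real k \<le> x * real L" "x * real L < real k + 1" unfolding k_def using xL by linarith+
        then have kL: "k \<le> L" using xL by linarith
        \<comment> \<open>Each site k is compared with the multiple of m just to its left, less than
          m sites away.\<close>
        define i where "i = k div m"
        have mi: "m * i \<le> k" "k < m * i + m"
          using m(3) by (auto simp: i_def) (metis add.commute dividend_less_times_div mult.commute)
        then have pti: "pt i = m * i" using kL by (simp add: pt_def)
        define j where "j = nat \<lfloor>t / \<delta>\<rfloor>"
        have "0 \<le> t / \<delta>" using t delta by simp
        then have "real j \<le> t / \<delta>" "t / \<delta> < real j + 1" unfolding j_def by linarith+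
        then have j: "real j * \<delta> \<le> t" "t \<le> real j * \<delta> + \<delta>" using delta by (auto simp: field_simps)
        have "real m * real i \<le> real L"
          using mi(1) kL by (metis of_nat_le_iff of_nat_mult order_trans)
        then have "\<theta> * real L * real i \<le> real L"
          using mult_right_mono[OF m(1), of "real i"] by simp
        then have "real i \<le> 1 / \<theta>" using L theta by (simp add: field_simps)
        then have "i \<le> nat \<lfloor>1 / \<theta>\<rfloor>" by (simp add: le_nat_floor)
        moreover have "j \<le> nat \<lfloor>T / \<delta>\<rfloor>"
          unfolding j_def using t delta by (intro nat_mono floor_mono divide_right_mono) auto
        ultimately have ij: "(i, j) \<in> I" by (simp add: I_def)
        have "real L ^ 2 * t \<in> {tm j..tm j + (real L)\<^sup>2 * \<delta>}"
          using mult_left_mono[OF j(1), of "(real L)\<^sup>2"] mult_left_mono[OF j(2), of "(real L)\<^sup>2"]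
          by (simp add: tm_def distrib_left)
        from W(3)[OF w ij this]
        have 1: "\<bar>real_of_int (h L (real L ^ 2 * t) \<omega> (m * i)) - u L (m * i) (tm j)\<bar> \<le> 3 * (\<eta> * real L)"
          by (simp only: pti)
        have "h L (real L ^ 2 * t) \<omega> \<in> Omega (M_L phi0 L) (N_L phi0 L)"
          using dyn w t by (auto simp: corner_flip_process_def markov_chain_gen_def)
        from Omega_lipschitz[OF this, of k "m * i"]
        have "\<bar>h L (real L ^ 2 * t) \<omega> k - h L (real L ^ 2 * t) \<omega> (m * i)\<bar> \<le> \<bar>int k - int (m * i)\<bar>"
          using kL mi by (simp add: size_eq)
        also have "\<dots> \<le> int m" using mi by linarith
        finally have "\<bar>h L (real L ^ 2 * t) \<omega> k - h L (real L ^ 2 * t) \<omega> (m * i)\<bar> \<le> int m" .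
        then have "real_of_int \<bar>h L (real L ^ 2 * t) \<omega> k - h L (real L ^ 2 * t) \<omega> (m * i)\<bar> \<le> real_of_int (int m)"
          by (simp only: of_int_le_iff)
        moreover have "real m \<le> 2 * (\<eta> * real L)"
          using m(2) mult_right_mono[OF theta(2), of "real L"] by simp
        ultimately have 2: "\<bar>real_of_int (h L (real L ^ 2 * t) \<omega> k) - real_of_int (h L (real L ^ 2 * t) \<omega> (m * i))\<bar>
            \<le> 2 * (\<eta> * real L)" by simp
        have jT: "real j * \<delta> \<in> {0..T}" using j(1) t delta by auto
        have 3: "\<bar>u L (m * i) (tm j) - real L * phi (real (m * i) / real L) (real j * \<delta>)\<bar> \<le> \<eta> * real L"
          unfolding tm_def using conv jT mi kL by (meson order_trans)
        have "\<bar>phi (real (m * i) / real L) (real j * \<delta>) - phi x t\<bar> \<le> \<eta>"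
        proof (rule phi_close[OF _ x jT t])
          have mk: "real (m * i) \<le> real k" "real k < real (m * i) + real m"
            using mi by (simp_all only: of_nat_le_iff of_nat_less_iff of_nat_add[symmetric])
          then show "real (m * i) / real L \<in> {0..1}" using kL L by (auto simp del: of_nat_mult)
          have "\<bar>real (m * i) - x * real L\<bar> < real m + 1" using mk k by linarith
          \<comment> \<open>Two shares of \<theta> L come from m, and one pays for the 1 lost in
            rounding x L down to k.\<close>
          also have "\<dots> \<le> 3 * \<theta> * real L" using m(2) Lth' by linarith
          also have "\<dots> < d / 2 * real L"
            using theta d(1) L by (intro mult_strict_right_mono) auto
          finally have "\<bar>real (m * i) - x * real L\<bar> < d / 2 * real L" .
          moreover have "\<bar>real (m * i) - x * real L\<bar> = \<bar>real (m * i) / real L - x\<bar> * real L"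
          proof -
            have "real (m * i) - x * real L = (real (m * i) / real L - x) * real L"
              using L by (simp add: left_diff_distrib)
            then show ?thesis by (simp only: abs_mult abs_of_nat)
          qed
          ultimately show "\<bar>real (m * i) / real L - x\<bar> < d / 2" using L by simp
          show "\<bar>real j * \<delta> - t\<bar> < d / 2" using j delta d(1) by linarith
        qed
        then have "real L * \<bar>phi (real (m * i) / real L) (real j * \<delta>) - phi x t\<bar> \<le> real L * \<eta>"
          by (rule mult_left_mono) simp
        then have 4: "\<bar>real L * phi (real (m * i) / real L) (real j * \<delta>) - real L * phi x t\<bar> \<le> \<eta> * real L"
          by (simp add: right_diff_distrib[symmetric] abs_mult mult.commute)
        have "\<eta> * real L = \<epsilon> * real L / 8" by (simp add: \<eta>_def)
        moreover have "0 \<le> \<eta> * real L" using eta by simp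
        ultimately show ?thesis using 1 2 3 4 unfolding k_def[symmetric] by linarith
      qed
      then show "\<omega> \<in> E L" using w L by (auto simp: E_def divide_le_eq)
    qed
    \<comment> \<open>\<open>measure\<close> assigns 0 to sets that are not measurable, so the lower
      bound depends on this.\<close>
    moreover have "E L \<in> sets (P L)"
      unfolding E_def by (rule uniform_event_measurable[OF dyn[rule_format] phi L T])
    ultimately have "prob (space (P L) - W) \<le> prob (E L)" by (intro finite_measure_mono)
    moreover have "prob (space (P L) - W) = 1 - prob W" using W(1) by (rule prob_compl)
    ultimately show "1 - K / real L \<le> prob (E L)" using W(2) by (simp add: K_def)
  qed
  have "(\<lambda>L. measure (P L) (E L)) \<longlonglongrightarrow> 1"
  proof (rule tendsto_sandwich[OF lower])
    show "\<forall>\<^sub>F L in sequentially. measure (P L) (E L) \<le> 1"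
      by (intro always_eventually allI prob_space.prob_le_1 prob)
    have "(\<lambda>L. 1 - K / real L) \<longlonglongrightarrow> 1 - 0"
      by (intro tendsto_diff tendsto_const lim_const_over_n)
    then show "(\<lambda>L. 1 - K / real L) \<longlonglongrightarrow> 1" by simp
  qed simp
  then show "(\<lambda>L. measure (P L) {\<omega> \<in> space (P L). \<forall>t\<in>{0..T}. \<forall>x\<in>{0..1}.
        \<bar>real_of_int (h L (real L ^ 2 * t) \<omega> (nat \<lfloor>x * real L\<rfloor>)) - real L * phi x t\<bar> / real L \<le> \<epsilon>})
    \<longlonglongrightarrow> 1" unfolding E_def .
qed

end
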